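(* A cograph is well-equi-hued if and only if its corresponding cotree satisfies the uniform assignment property.
   Context: All graphs are finite and simple. For $k\ge 1$, a maximal $k$-colorable subgraph of $G$ is a subgraph induced by a set $S\subseteq V(G)$ such that $G[S]$ is (properly) $k$-colorable and $G[S']$ is not $k$-colorable for every $S'$ with $S\subsetneq S'\subseteq V(G)$. $G$ is well-hued if for every $k\ge 1$ all maximal $k$-colorable subgraphs of $G$ have the same order, denoted $a_k$. A graph $G$ of order $n$ with chromatic number $\chi$ is well-equi-hued if it is well-hued and $a_i=\frac{i}{\chi}n$ for all $i\in\{1,\dots,\chi\}$. Cographs are the smallest class of graphs containing $K_1$ and closed under disjoint unions and joins (the join of graphs is their disjoint union together with all edges between different graphs). The cotree $T_G$ of a cograph $G$ is the (unique) rooted tree such that: its leaves are labeled with the vertices of $G$; each internal (non-leaf) node is labeled $0$ (disjoint union) or $1$ (join), with no two adjacent internal nodes having the same label; every internal node has two or more children, unless $G$ is a single vertex; and $G$ is obtained by letting each leaf represent a single-vertex graph, each $0$-node the disjoint union of the graphs represented by its children, and each $1$-node the join of the graphs represented by its children, with the root representing $G$. Procedure 1 on a cotree: assign the value 1 to each leaf; to each internal node at even distance from the root (including the root) assign the sum of the values of its children; to each internal node at odd distance from the root assign the maximum of the values of its children. Procedure 2: assign the value 1 to each leaf; to each internal node at odd distance from the root assign the sum of the values of its children; to each internal node at even distance from the root assign the maximum of the values of its children. The cotree $T_G$ satisfies the uniform assignment property if (i) when values are assigned by Procedure 1, for every node $v$ at odd distance from the root all children of $v$ have the same value, and (ii)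 when values are assigned by Procedure 2, for every node $v$ at even distance from the root all children of $v$ have the same value. *)

theory Defs
  imports "Graph_Theory.Graph_Theory" "HOL-Library.Multiset" Complex_Main
begin

text \<open>
  A finite simple graph is a \<^locale>\<open>pair_graph\<close>: a finite vertex set with a symmetric,
  loop-free set of vertex pairs.
\<close>

section \<open>Colorings and well-hued graphs\<close>

definition colorable :: "('a, 'b) pre_digraph \<Rightarrow> nat \<Rightarrow> bool" where
  "colorable G k \<longleftrightarrow>
     (\<exists>f :: 'a \<Rightarrow> nat. (\<forall>v \<in> verts G. f v < k) \<and> (\<forall>(u, v) \<in> arcs_ends G. f u \<noteq> f v))"

definition chromatic_number :: "('a, 'b) pre_digraph \<Rightarrow> nat" where
  "chromatic_number G = (LEAST k. colorable G k)"

definition maximal_colorable :: "('a, 'b) pre_digraph \<Rightarrow> nat \<Rightarrow> 'a set \<Rightarrow> bool" where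
  "maximal_colorable G k S \<longleftrightarrow>
     S \<subseteq> verts G \<and> colorable (G \<restriction> S) k \<and>
     (\<forall>S'. S \<subset> S' \<and> S' \<subseteq> verts G \<longrightarrow> \<not> colorable (G \<restriction> S') k)"

definition well_hued :: "('a, 'b) pre_digraph \<Rightarrow> bool" where
  "well_hued G \<longleftrightarrow>
     (\<forall>k \<ge> 1. \<forall>S S'. maximal_colorable G k S \<and> maximal_colorable G k S' \<longrightarrow> card S = card S')"

text \<open>The number \<open>a\<^sub>k\<close>; meaningful when \<open>G\<close> is finite and well-hued and \<open>k \<ge> 1\<close>.\<close>

definition hue_number :: "('a, 'b) pre_digraph \<Rightarrow> nat \<Rightarrow> nat" where
  "hue_number G k = (THE m. \<exists>S. maximal_colorable G k S \<and> card S = m)"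

definition well_equi_hued :: "('a, 'b) pre_digraph \<Rightarrow> bool" where
  "well_equi_hued G \<longleftrightarrow> well_hued G \<and>
     (\<forall>i \<in> {1..chromatic_number G}.
        real (hue_number G i) = real i / real (chromatic_number G) * real (card (verts G)))"

section \<open>Cographs\<close>

text \<open>
  Union and join of a set of graphs. These are used only for graphs with pairwise disjoint,
  nonempty vertex sets, where they are the disjoint union and the join.
\<close>

definition graph_union :: "'a pair_pre_digraph set \<Rightarrow> 'a pair_pre_digraph" where
  "graph_union Gs = \<lparr> pverts = (\<Union>G \<in> Gs. pverts G), parcs = (\<Union>G \<in> Gs. parcs G) \<rparr>"

definition graph_join :: "'a pair_pre_digraph set \<Rightarrow> 'a pair_pre_digraph" where
  "graph_join Gs = \<lparr> pverts = (\<Union>G \<in> Gs. pverts G),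
     parcs = (\<Union>G \<in> Gs. parcs G) \<union> (\<Union>G \<in> Gs. \<Union>H \<in> Gs - {G}. pverts G \<times> pverts H) \<rparr>"

text \<open>
  Any one-vertex graph is admitted as \<open>K\<^sub>1\<close>, so that the class is closed under renaming of
  vertices and the disjointness conditions below are no restriction.
\<close>

inductive cograph :: "'a pair_pre_digraph \<Rightarrow> bool" where
  single: "K\<^bsub>1\<^esub> (with_proj G) \<Longrightarrow> cograph G"
| disjoint_union:
    "\<lbrakk>cograph G; cograph H; pverts G \<inter> pverts H = {}\<rbrakk> \<Longrightarrow> cograph (graph_union {G, H})"
| join:
    "\<lbrakk>cograph G; cograph H; pverts G \<inter> pverts H = {}\<rbrakk> \<Longrightarrow> cograph (graph_join {G, H})"

section \<open>Cotrees\<close>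

text \<open>\<open>L0\<close> stands for disjoint union and \<open>L1\<close> for join.\<close>

datatype node_label = L0 | L1

text \<open>The children of a node are unordered, hence a multiset.\<close>

datatype 'a cotree =
    Leaf 'a
  | Node node_label (children: "'a cotree multiset")
where "children (Leaf v) = {#}"

text \<open>\<open>node_at T d t\<close>: \<open>T\<close> has a node at distance \<open>d\<close> from its root at which the subtree \<open>t\<close>
  is rooted.\<close>

inductive node_at :: "'a cotree \<Rightarrow> nat \<Rightarrow> 'a cotree \<Rightarrow> bool" for T where
  root: "node_at T 0 T"
| child: "\<lbrakk>node_at T d t; c \<in># children t\<rbrakk> \<Longrightarrow> node_at T (Suc d) c"

primrec leaves :: "'a cotree \<Rightarrow> 'a multiset" where
  "leaves (Leaf v) = {#v#}"
| "leaves (Node l cs) = \<Sum>\<^sub># (image_mset leaves cs)"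

fun combine :: "node_label \<Rightarrow> 'a pair_pre_digraph set \<Rightarrow> 'a pair_pre_digraph" where
  "combine L0 Gs = graph_union Gs"
| "combine L1 Gs = graph_join Gs"

primrec cotree_graph :: "'a cotree \<Rightarrow> 'a pair_pre_digraph" where
  "cotree_graph (Leaf v) = \<lparr> pverts = {v}, parcs = {} \<rparr>"
| "cotree_graph (Node l cs) = combine l (set_mset (image_mset cotree_graph cs))"

definition proper_cotree :: "'a cotree \<Rightarrow> bool" where
  "proper_cotree T \<longleftrightarrow>
     (\<forall>d l cs. node_at T d (Node l cs) \<longrightarrow> size cs \<ge> 2 \<and> (\<forall>l' ds. Node l' ds \<in># cs \<longrightarrow> l' \<noteq> l))"

text \<open>
  The condition on \<open>leaves T\<close> says that every vertex of \<open>G\<close> labels exactly one leaf of \<open>T\<close>.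
\<close>

definition is_cotree :: "'a cotree \<Rightarrow> 'a pair_pre_digraph \<Rightarrow> bool" where
  "is_cotree T G \<longleftrightarrow>
     leaves T = mset_set (pverts G) \<and> proper_cotree T \<and> cotree_graph T = G"

text \<open>Existence and uniqueness for cographs are proved in \<open>cograph_ex1_cotree\<close> below.\<close>

definition cotree_of :: "'a pair_pre_digraph \<Rightarrow> 'a cotree" where
  "cotree_of G = (THE T. is_cotree T G)"

section \<open>The uniform assignment property\<close>

text \<open>
  \<open>node_value P t d\<close> is the value of a node at distance \<open>d\<close> from the root whose subtree is \<open>t\<close>,
  where the nodes at the distances satisfying \<open>P\<close> take sums and the others take maxima.
  The two procedures are \<open>P = even\<close> and \<open>P = odd\<close>.
\<close>

primrec node_value :: "(nat \<Rightarrow> bool) \<Rightarrow> 'a cotree \<Rightarrow> nat \<Rightarrow> nat" where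
  "node_value P (Leaf v) d = 1"
| "node_value P (Node l cs) d =
     (if P d then \<Sum>\<^sub># (image_mset (\<lambda>c. node_value P c (Suc d)) cs)
      else Max (set_mset (image_mset (\<lambda>c. node_value P c (Suc d)) cs)))"

definition uniform_assignment_property :: "'a cotree \<Rightarrow> bool" where
  "uniform_assignment_property T \<longleftrightarrow>
     (\<forall>d t. node_at T d t \<and> odd d \<longrightarrow>
        (\<forall>x \<in># children t. \<forall>y \<in># children t.
           node_value even x (Suc d) = node_value even y (Suc d))) \<and>
     (\<forall>d t. node_at T d t \<and> even d \<longrightarrow>
        (\<forall>x \<in># children t. \<forall>y \<in># children t.
           node_value odd x (Suc d) = node_value odd y (Suc d)))"


section \<open>Existence and uniqueness of the cotree\<close>

lemma pair_pre_digraph_eqI: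
  fixes G H :: "'a pair_pre_digraph"
  shows "pverts G = pverts H \<Longrightarrow> parcs G = parcs H \<Longrightarrow> G = H"
  by simp

lemma pair_graph_iff:
  "pair_graph G \<longleftrightarrow> finite (pverts G) \<and> parcs G \<subseteq> pverts G \<times> pverts G \<and>
     (\<forall>u v. (u, v) \<in> parcs G \<longrightarrow> u \<noteq> v \<and> (v, u) \<in> parcs G)"
proof
  assume "pair_graph G"
  then interpret pair_graph G .
  show "finite (pverts G) \<and> parcs G \<subseteq> pverts G \<times> pverts G \<and>
     (\<forall>u v. (u, v) \<in> parcs G \<longrightarrow> u \<noteq> v \<and> (v, u) \<in> parcs G)"
    using pair_finite_verts arc_fst_in_verts arc_snd_in_verts pair_no_loops pair_sym_arcs
    by (fastforce simp: symmetric_def sym_def)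
next
  assume "finite (pverts G) \<and> parcs G \<subseteq> pverts G \<times> pverts G \<and>
     (\<forall>u v. (u, v) \<in> parcs G \<longrightarrow> u \<noteq> v \<and> (v, u) \<in> parcs G)"
  then have *: "finite (pverts G)" "parcs G \<subseteq> pverts G \<times> pverts G"
    "\<And>u v. (u, v) \<in> parcs G \<Longrightarrow> u \<noteq> v" "\<And>u v. (u, v) \<in> parcs G \<Longrightarrow> (v, u) \<in> parcs G"
    by blast+
  then have "finite (parcs G)" by (meson finite_SigmaI finite_subset)
  moreover have "symmetric G" using *(4) by (simp add: symmetric_def symI)
  ultimately show "pair_graph G"
    using *(1,2) by unfold_locales (use *(3) in \<open>auto\<close>)
qed

lemma cograph_pair_graph: "cograph G \<Longrightarrow> pair_graph G"
proof (induction rule: cograph.induct)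
  case (single G)
  then have "finite (pverts G)" "parcs G = {(u, v). (u, v) \<in> pverts G \<times> pverts G \<and> u \<noteq> v}"
    using complete_digraph_pair_def[of 1 G] by auto
  then show ?case by (auto simp: pair_graph_iff)
next
  case (disjoint_union G H)
  then show ?case unfolding pair_graph_iff by (simp add: graph_union_def) blast
next
  case (join G H)
  then show ?case unfolding pair_graph_iff by (simp add: graph_join_def) blast
qed

lemma node_at_Leaf: "node_at (Leaf v) d t \<longleftrightarrow> d = 0 \<and> t = Leaf v"
proof
  assume "node_at (Leaf v) d t"
  then show "d = 0 \<and> t = Leaf v" by induction auto
qed (auto intro: node_at.root)

lemma node_at_Node:
  "node_at (Node l cs) d t \<longleftrightarrow>
     d = 0 \<and> t = Node l cs \<or> (\<exists>d' c. d = Suc d' \<and> c \<in># cs \<and> node_at c d' t)"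
proof
  assume "node_at (Node l cs) d t"
  then show "d = 0 \<and> t = Node l cs \<or> (\<exists>d' c. d = Suc d' \<and> c \<in># cs \<and> node_at c d' t)"
    by induction (auto intro: node_at.intros)
next
  have "node_at (Node l cs) (Suc d') t" if "c \<in># cs" "node_at c d' t" for d' c
    using that(2,1)
  proof induction
    case root
    then show ?case using node_at.child[OF node_at.root, of c "Node l cs"] by simp
  next
    case (child d t c)
    then show ?case by (auto intro: node_at.child)
  qed
  then show "node_at (Node l cs) d t"
    if "d = 0 \<and> t = Node l cs \<or> (\<exists>d' c. d = Suc d' \<and> c \<in># cs \<and> node_at c d' t)"
    using that by (auto intro: node_at.root)
qed

lemma proper_cotree_Leaf [simp]: "proper_cotree (Leaf v)"
  by (simp add: proper_cotree_def node_at_Leaf)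

lemma proper_cotree_Node:
  "proper_cotree (Node l cs) \<longleftrightarrow>
     size cs \<ge> 2 \<and> (\<forall>l' ds. Node l' ds \<in># cs \<longrightarrow> l' \<noteq> l) \<and> (\<forall>c \<in># cs. proper_cotree c)"
proof -
  have "(\<forall>d l' ds. node_at (Node l cs) d (Node l' ds) \<longrightarrow> Q l' ds) \<longleftrightarrow>
      Q l cs \<and> (\<forall>c \<in># cs. \<forall>d l' ds. node_at c d (Node l' ds) \<longrightarrow> Q l' ds)" (is "?L \<longleftrightarrow> ?R") for Q
  proof
    assume L: ?L
    have "Q l' ds" if "c \<in># cs" "node_at c d (Node l' ds)" for c d l' ds
    proof -
      have "node_at (Node l cs) (Suc d) (Node l' ds)" using that by (auto simp: node_at_Node)
      with L show ?thesis by blast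
    qed
    with L show ?R using node_at.root[of "Node l cs"] by blast
  next
    assume ?R
    then show ?L by (auto simp: node_at_Node)
  qed
  from this[of "\<lambda>l cs. size cs \<ge> 2 \<and> (\<forall>l' ds. Node l' ds \<in># cs \<longrightarrow> l' \<noteq> l)"] show ?thesis
    unfolding proper_cotree_def by (simp only: conj_assoc)
qed

lemma pverts_combine [simp]: "pverts (combine l Gs) = (\<Union>G \<in> Gs. pverts G)"
  by (cases l) (auto simp: graph_union_def graph_join_def)

lemma pverts_cotree_graph: "pverts (cotree_graph T) = set_mset (leaves T)"
  by (induction T) auto

lemma leaves_nonempty: "proper_cotree T \<Longrightarrow> leaves T \<noteq> {#}"
proof (induction T)
  case (Node l cs)
  then obtain c where "c \<in># cs" by (fastforce simp: proper_cotree_Node)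
  with Node show ?case by (auto simp: proper_cotree_Node)
qed simp

lemma parcs_cotree_graph: "parcs (cotree_graph T) \<subseteq> set_mset (leaves T) \<times> set_mset (leaves T)"
proof (induction T)
  case (Node l cs)
  then have "u \<in># leaves c \<and> v \<in># leaves c"
    if "c \<in># cs" "(u, v) \<in> parcs (cotree_graph c)" for c u v using that by blast
  then show ?case
    by (cases l) (auto simp: graph_union_def graph_join_def pverts_cotree_graph)
qed simp

definition distinct_leaves :: "'a cotree \<Rightarrow> bool" where
  "distinct_leaves T \<longleftrightarrow> (\<forall>v. count (leaves T) v \<le> 1)"

lemma distinct_leaves_iff: "distinct_leaves T \<longleftrightarrow> leaves T = mset_set (set_mset (leaves T))"
proof
  assume d: "distinct_leaves T"
  show "leaves T = mset_set (set_mset (leaves T))"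
  proof (rule multiset_eqI)
    fix v
    have "count (leaves T) v \<le> 1" using d by (simp add: distinct_leaves_def)
    then show "count (leaves T) v = count (mset_set (set_mset (leaves T))) v"
      by (cases "v \<in># leaves T")
        (auto simp: count_mset_set' le_Suc_eq count_eq_zero_iff)
  qed
next
  assume "leaves T = mset_set (set_mset (leaves T))"
  then have "count (leaves T) v = count (mset_set (set_mset (leaves T))) v" for v by simp
  then show "distinct_leaves T" by (auto simp: distinct_leaves_def count_mset_set')
qed

lemma is_cotree_iff:
  "is_cotree T G \<longleftrightarrow> distinct_leaves T \<and> proper_cotree T \<and> cotree_graph T = G"
  unfolding is_cotree_def distinct_leaves_iff using pverts_cotree_graph[of T] by auto

lemma distinct_leaves_Node:
  assumes "distinct_leaves (Node l cs)" "proper_cotree (Node l cs)"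
  shows "\<And>c. c \<in># cs \<Longrightarrow> distinct_leaves c"
    and "\<And>c c'. \<lbrakk>c \<in># cs; c' \<in># cs; c \<noteq> c'\<rbrakk> \<Longrightarrow> set_mset (leaves c) \<inter> set_mset (leaves c') = {}"
    and "\<And>c. count cs c \<le> 1"
proof -
  have le: "count (leaves c) v + count (\<Sum>\<^sub># (image_mset leaves (cs - {#c#}))) v \<le> 1"
    if "c \<in># cs" for c v
  proof -
    have "leaves (Node l cs) = leaves c + \<Sum>\<^sub># (image_mset leaves (cs - {#c#}))"
      using that by (metis image_mset_add_mset insert_DiffM leaves.simps(2) sum_mset.add_mset)
    then show ?thesis using assms(1) by (metis count_union distinct_leaves_def)
  qed
  then show "distinct_leaves c" if "c \<in># cs" for c
    using that by (meson add_leD1 distinct_leaves_def)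
  have disj: "set_mset (leaves c) \<inter> set_mset (leaves c') = {}"
    if c: "c \<in># cs" and c': "c' \<in># cs - {#c#}" for c c'
  proof -
    have False if "v \<in># leaves c" "v \<in># leaves c'" for v
    proof -
      have "v \<in># \<Sum>\<^sub># (image_mset leaves (cs - {#c#}))" using that c' by auto
      with that(1) have "count (leaves c) v > 0"
        "count (\<Sum>\<^sub># (image_mset leaves (cs - {#c#}))) v > 0"
        by (simp_all only: count_greater_zero_iff)
      then show False using le[OF c, of v] by linarith
    qed
    then show ?thesis by auto
  qed
  show "set_mset (leaves c) \<inter> set_mset (leaves c') = {}"
    if "c \<in># cs" "c' \<in># cs" "c \<noteq> c'" for c c'
    using that disj[of c c'] by (simp add: in_diff_count)
  show "count cs c \<le> 1" for c
  proof (rule ccontr)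
    assume "\<not> count cs c \<le> 1"
    then have "c \<in># cs" "c \<in># cs - {#c#}"
      by (auto simp flip: count_greater_zero_iff)
    with disj[of c c] show False
      using leaves_nonempty[of c] assms(2) by (auto simp: proper_cotree_Node)
  qed
qed

text \<open>If \<open>l\<close> is the label of the root, then vertices related by \<open>sep l\<close> lie below the same child
  of the root, and vertices below the same child are \<open>near\<close>.\<close>

definition sep :: "node_label \<Rightarrow> 'a pair_pre_digraph \<Rightarrow> 'a rel" where
  "sep l G = (if l = L0 then parcs G else (pverts G \<times> pverts G) - Id - parcs G)"

definition near :: "node_label \<Rightarrow> 'a pair_pre_digraph \<Rightarrow> 'a \<Rightarrow> 'a \<Rightarrow> bool" where
  "near l G u v \<longleftrightarrow> u = v \<or> (u, v) \<in> sep l G \<or> (\<exists>w. (u, w) \<in> sep l G \<and> (w, v) \<in> sep l G)"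

lemma parcs_child:
  assumes "distinct_leaves (Node l cs)" "proper_cotree (Node l cs)" "c \<in># cs"
    "u \<in># leaves c" "v \<in># leaves c"
  shows "(u, v) \<in> parcs (cotree_graph (Node l cs)) \<longleftrightarrow> (u, v) \<in> parcs (cotree_graph c)"
proof -
  have eq: "c' = c" if "c' \<in># cs" "x \<in># leaves c'" "x = u \<or> x = v" for c' x
    using distinct_leaves_Node(2)[OF assms(1,2) that(1) assms(3)] that assms(4,5) by auto
  have eq_arc: "d = c" if "d \<in># cs" "(u, v) \<in> parcs (cotree_graph d)" for d
    using eq[OF that(1), of u] that(2) parcs_cotree_graph[of d] by blast
  show ?thesis
  proof (cases l)
    case L0
    then show ?thesis using eq_arc assms(3) by (auto simp: graph_union_def)
  next
    case L1
    let ?Gs = "cotree_graph ` set_mset cs"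
    have "(u, v) \<in> parcs (cotree_graph (Node l cs)) \<longleftrightarrow> (\<exists>G \<in> ?Gs. (u, v) \<in> parcs G) \<or>
        (\<exists>G \<in> ?Gs. u \<in> pverts G \<and> (\<exists>H \<in> ?Gs - {G}. v \<in> pverts H))"
      by (simp add: L1 graph_join_def)
    moreover have False if uv: "G \<in> ?Gs" "u \<in> pverts G" "H \<in> ?Gs - {G}" "v \<in> pverts H" for G H
    proof -
      obtain d d' where d: "d \<in># cs" "G = cotree_graph d" "d' \<in># cs" "H = cotree_graph d'"
        using uv(1,3) by blast
      then have "d = c" "d' = c" using eq uv(2,4) by (auto simp: pverts_cotree_graph)
      with d uv(3) show False by simp
    qed
    ultimately have "(u, v) \<in> parcs (cotree_graph (Node l cs)) \<longleftrightarrow> (\<exists>G \<in> ?Gs. (u, v) \<in> parcs G)"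
      by blast
    then show ?thesis using eq_arc assms(3) by blast
  qed
qed

lemma parcs_across:
  assumes "distinct_leaves (Node l cs)" "proper_cotree (Node l cs)" "c \<in># cs" "c' \<in># cs"
    "c \<noteq> c'" "u \<in># leaves c" "v \<in># leaves c'"
  shows "(u, v) \<in> parcs (cotree_graph (Node l cs)) \<longleftrightarrow> l = L1"
proof -
  have no: "(u, v) \<notin> parcs (cotree_graph d)" if "d \<in># cs" for d
  proof
    assume "(u, v) \<in> parcs (cotree_graph d)"
    then have "u \<in># leaves d" "v \<in># leaves d" using parcs_cotree_graph by blast+
    then have "d = c" "d = c'" using distinct_leaves_Node(2)[OF assms(1,2)] that assms by blast+
    then show False using assms(5) by simp
  qed
  show ?thesis
  proof (cases l)
    case L0
    then show ?thesis using no by (auto simp: graph_union_def)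
  next
    case L1
    have "cotree_graph c \<noteq> cotree_graph c'"
      using distinct_leaves_Node(2)[OF assms(1,2,3,4,5)] assms(6,7)
        pverts_cotree_graph[of c] pverts_cotree_graph[of c'] by auto
    then have "(u, v) \<in> (\<Union>G \<in> cotree_graph ` set_mset cs.
        \<Union>H \<in> cotree_graph ` set_mset cs - {G}. pverts G \<times> pverts H)"
      using assms by (intro UN_I[of "cotree_graph c"] UN_I[of "cotree_graph c'"])
        (auto simp: pverts_cotree_graph)
    then show ?thesis using L1 by (simp add: graph_join_def)
  qed
qed

lemma sep_same_child:
  assumes "distinct_leaves (Node l cs)" "proper_cotree (Node l cs)" "c \<in># cs"
    "u \<in># leaves c" "(u, v) \<in> sep l (cotree_graph (Node l cs))"
  shows "v \<in># leaves c"
proof -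
  have "v \<in> pverts (cotree_graph (Node l cs))"
    using assms(5) parcs_cotree_graph[of "Node l cs"] pverts_cotree_graph[of "Node l cs"]
    by (auto simp: sep_def split: if_splits)
  then obtain c' where c': "c' \<in># cs" "v \<in># leaves c'" by (auto simp: pverts_cotree_graph)
  show ?thesis
  proof (cases "c = c'")
    case False
    with parcs_across[OF assms(1,2,3) c'(1) False assms(4) c'(2)] assms(5) show ?thesis
      by (cases l) (auto simp: sep_def)
  qed (use c' in simp)
qed

lemma near_same_child:
  assumes "distinct_leaves (Node l cs)" "proper_cotree (Node l cs)" "c \<in># cs"
    "u \<in># leaves c" "near l (cotree_graph (Node l cs)) u v"
  shows "v \<in># leaves c"
proof -
  have step: "y \<in># leaves c"
    if "x \<in># leaves c" "(x, y) \<in> sep l (cotree_graph (Node l cs))" for x y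
    using sep_same_child[OF assms(1-3) that] .
  from assms(5) consider "u = v" | "(u, v) \<in> sep l (cotree_graph (Node l cs))"
    | w where "(u, w) \<in> sep l (cotree_graph (Node l cs))"
        "(w, v) \<in> sep l (cotree_graph (Node l cs))"
    unfolding near_def by blast
  then show ?thesis
  proof cases
    case 1
    then show ?thesis using assms(4) by simp
  next
    case 2
    then show ?thesis by (rule step[OF assms(4)])
  next
    case (3 w)
    show ?thesis by (rule step[OF step[OF assms(4) 3(1)] 3(2)])
  qed
qed

lemma two_children:
  assumes "distinct_leaves (Node l cs)" "proper_cotree (Node l cs)" "c \<in># cs"
  obtains c' where "c' \<in># cs" "c' \<noteq> c"
proof -
  have "size (cs - {#c#}) > 0" using assms by (simp add: proper_cotree_Node size_Diff_singleton)
  then obtain c' where c': "c' \<in># cs - {#c#}" by (metis nonempty_has_size multiset_nonemptyE)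
  moreover have "c' \<noteq> c" using c' distinct_leaves_Node(3)[OF assms(1,2), of c]
    by (metis One_nat_def count_diff count_greater_zero_iff count_single diff_is_0_eq
        less_numeral_extra(3))
  ultimately show ?thesis using that by (meson in_diffD)
qed

lemma near_root:
  assumes "distinct_leaves (Node l cs)" "proper_cotree (Node l cs)" "l \<noteq> l'"
    "u \<in># leaves (Node l cs)" "v \<in># leaves (Node l cs)"
  shows "near l' (cotree_graph (Node l cs)) u v"
proof -
  let ?G = "cotree_graph (Node l cs)"
  have across: "(x, y) \<in> sep l' ?G"
    if "c \<in># cs" "c' \<in># cs" "c \<noteq> c'" "x \<in># leaves c" "y \<in># leaves c'" for c c' x y
  proof -
    have "x \<noteq> y" using distinct_leaves_Node(2)[OF assms(1,2) that(1-3)] that by auto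
    moreover have "x \<in> pverts ?G" "y \<in> pverts ?G" using that by (auto simp: pverts_cotree_graph)
    ultimately show ?thesis using parcs_across[OF assms(1,2) that] assms(3)
      by (cases l; cases l') (auto simp: sep_def)
  qed
  obtain c where c: "c \<in># cs" "u \<in># leaves c" using assms(4) by auto
  obtain d where d: "d \<in># cs" "v \<in># leaves d" using assms(5) by auto
  show ?thesis
  proof (cases "c = d")
    case False
    then show ?thesis using across c d by (auto simp: near_def)
  next
    case True
    obtain e where e: "e \<in># cs" "e \<noteq> c" using two_children[OF assms(1,2) c(1)] by blast
    then obtain w where "w \<in># leaves e"
      using leaves_nonempty[of e] assms(2) by (auto simp: proper_cotree_Node)
    then have "(u, w) \<in> sep l' ?G" "(w, v) \<in> sep l' ?G"
      using across[OF c(1) e(1) _ c(2)] across[OF e(1) d(1) _ _ d(2)] e(2) True by auto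
    then show ?thesis unfolding near_def by blast
  qed
qed

lemma near_child:
  assumes "distinct_leaves (Node l cs)" "proper_cotree (Node l cs)" "c \<in># cs"
    "u \<in># leaves c" "v \<in># leaves c"
  shows "near l (cotree_graph (Node l cs)) u v"
proof (cases c)
  case (Leaf x)
  then show ?thesis using assms by (simp add: near_def)
next
  case (Node l' ds)
  have "l' \<noteq> l" "proper_cotree c" using assms(2,3) Node proper_cotree_Node[of l cs] by blast+
  moreover have "distinct_leaves c" using distinct_leaves_Node(1) assms by blast
  ultimately have near: "near l (cotree_graph c) u v"
    using near_root[of l' ds l u v] assms(4,5) unfolding Node by blast
  have "(x, y) \<in> sep l (cotree_graph (Node l cs))" if "(x, y) \<in> sep l (cotree_graph c)" for x y
  proof -
    have xy: "x \<in># leaves c" "y \<in># leaves c"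
      using that parcs_cotree_graph[of c] pverts_cotree_graph[of c]
      by (auto simp: sep_def split: if_splits)
    then have "x \<in> pverts (cotree_graph (Node l cs))" "y \<in> pverts (cotree_graph (Node l cs))"
      using assms(3) by (auto simp: pverts_cotree_graph)
    then show ?thesis
      using that parcs_child[OF assms(1-3) xy] by (auto simp: sep_def simp del: cotree_graph.simps)
  qed
  with near show ?thesis unfolding near_def by blast
qed

lemma leaves_child:
  assumes "distinct_leaves (Node l cs)" "proper_cotree (Node l cs)" "c \<in># cs" "u \<in># leaves c"
  shows "set_mset (leaves c) = {v. near l (cotree_graph (Node l cs)) u v}"
  using near_child[OF assms] near_same_child[OF assms] by blast

lemma parcs_child_eq:
  assumes "distinct_leaves (Node l cs)" "proper_cotree (Node l cs)" "c \<in># cs"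
  shows "parcs (cotree_graph c) =
    parcs (cotree_graph (Node l cs)) \<inter> set_mset (leaves c) \<times> set_mset (leaves c)"
  using parcs_child[OF assms] parcs_cotree_graph[of c] by blast

lemma cotree_unique:
  "\<lbrakk>distinct_leaves T; proper_cotree T; distinct_leaves T'; proper_cotree T';
    cotree_graph T = cotree_graph T'\<rbrakk> \<Longrightarrow> T = T'"
proof (induction T arbitrary: T')
  case (Leaf v)
  show ?case
  proof (cases T')
    case (Leaf w)
    then show ?thesis using Leaf.prems by simp
  next
    case (Node l cs)
    have sub: "set_mset (leaves T') = {v}" using Leaf.prems(5)[symmetric] pverts_cotree_graph[of T'] by simp
    have pc: "distinct_leaves (Node l cs)" "proper_cotree (Node l cs)"
      using Leaf.prems Node by auto
    then have "cs \<noteq> {#}" by (auto simp: proper_cotree_Node)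
    then obtain c where c: "c \<in># cs" by blast
    then obtain d where d: "d \<in># cs" "d \<noteq> c" using two_children[OF pc] by blast
    have "leaves c \<noteq> {#}" "leaves d \<noteq> {#}"
      using leaves_nonempty c d pc by (auto simp: proper_cotree_Node)
    moreover have "set_mset (leaves c) \<subseteq> {v}" "set_mset (leaves d) \<subseteq> {v}"
      using sub c d Node by auto
    ultimately have "v \<in># leaves c" "v \<in># leaves d"
      by (metis set_mset_eq_empty_iff subset_singletonD insertI1)+
    then show ?thesis using distinct_leaves_Node(2)[OF pc d(1) c d(2)] by auto
  qed
next
  case (Node l cs)
  note T = Node.prems(1,2)
  have vs: "leaves (Node l cs) \<noteq> {#}"
    and eqv: "set_mset (leaves (Node l cs)) = set_mset (leaves T')"
    using leaves_nonempty[OF T(2)] Node.prems(5) pverts_cotree_graph by metis+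
  from T have "cs \<noteq> {#}" by (auto simp: proper_cotree_Node)
  then obtain c where c: "c \<in># cs" by blast
  then obtain d where d: "d \<in># cs" "d \<noteq> c" using two_children[OF T] by blast
  obtain u where u: "u \<in># leaves c"
    using leaves_nonempty c T by (fastforce simp: proper_cotree_Node)
  obtain v where v: "v \<in># leaves d"
    using leaves_nonempty d T by (fastforce simp: proper_cotree_Node)
  have vc: "v \<notin># leaves c" using distinct_leaves_Node(2)[OF T d(1) c d(2)] v by auto
  have uv: "u \<in># leaves T'" "v \<in># leaves T'" using u v c d(1) by (auto simp flip: eqv)
  obtain l' cs' where T': "T' = Node l' cs'"
    using uv u vc by (cases T') auto
  have T'p: "distinct_leaves (Node l' cs')" "proper_cotree (Node l' cs')"
    using Node.prems T' by auto
  have "l' = l"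
  proof (rule ccontr)
    assume "l' \<noteq> l"
    then have "near l (cotree_graph T') u v" using near_root[OF T'p] uv T' by metis
    then have "v \<in># leaves c" using near_same_child[OF T c u] Node.prems(5) by metis
    with vc show False ..
  qed
  with T' T'p have T': "T' = Node l cs'" "distinct_leaves (Node l cs')" "proper_cotree (Node l cs')"
    by auto
  have graph: "cotree_graph (Node l cs) = cotree_graph (Node l cs')" using Node.prems(5) T'(1) by simp
  have same: "e = e'"
    if e: "e \<in># cs" "e' \<in># cs'" "x \<in># leaves e" "x \<in># leaves e'" for e e' x
  proof (rule Node.IH[OF e(1)])
    have "set_mset (leaves e) = set_mset (leaves e')"
      using leaves_child[OF T e(1,3)] leaves_child[OF T'(2,3) e(2,4)] graph by simp
    then have "pverts (cotree_graph e) = pverts (cotree_graph e')"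
        "parcs (cotree_graph e) = parcs (cotree_graph e')"
      using parcs_child_eq[OF T e(1)] parcs_child_eq[OF T'(2,3) e(2)] graph
      by (simp_all only: pverts_cotree_graph)
    then show "cotree_graph e = cotree_graph e'" by (rule pair_pre_digraph_eqI)
  qed (use e T T' distinct_leaves_Node(1) in \<open>auto simp: proper_cotree_Node\<close>)
  have "set_mset cs \<subseteq> set_mset cs'"
  proof
    fix e assume e: "e \<in># cs"
    then obtain x where x: "x \<in># leaves e"
      using leaves_nonempty T by (fastforce simp: proper_cotree_Node)
    then have "x \<in># leaves (Node l cs')" using e eqv T'(1) by auto
    then obtain e' where "e' \<in># cs'" "x \<in># leaves e'" by auto
    then show "e \<in># cs'" using same e x by blast
  qed
  moreover have "set_mset cs' \<subseteq> set_mset cs"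
  proof
    fix e' assume e': "e' \<in># cs'"
    then obtain x where x: "x \<in># leaves e'"
      using leaves_nonempty T' by (fastforce simp: proper_cotree_Node)
    then have "x \<in># leaves (Node l cs)" using e' eqv T'(1) by auto
    then obtain e where "e \<in># cs" "x \<in># leaves e" by auto
    then show "e' \<in># cs" using same e' x by blast
  qed
  ultimately have "set_mset cs = set_mset cs'" by blast
  moreover have "count cs e = count cs' e" if "e \<in># cs" "e \<in># cs'" for e
    using that distinct_leaves_Node(3)[OF T, of e] distinct_leaves_Node(3)[OF T'(2,3), of e]
    by (meson count_greater_eq_one_iff le_antisym order_trans)
  ultimately have "cs = cs'" by (metis multiset_eqI not_in_iff)
  then show ?case using T'(1) by simp
qed

text \<open>The children that \<open>T\<close> contributes to a new root labeled \<open>l\<close>.\<close>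

fun parts :: "node_label \<Rightarrow> 'a cotree \<Rightarrow> 'a cotree multiset" where
  "parts l (Leaf v) = {#Leaf v#}"
| "parts l (Node l' cs) = (if l' = l then cs else {#Node l' cs#})"

lemma combine_single: "combine l {G} = G"
  by (cases l) (auto simp: graph_union_def graph_join_def)

lemma combine_parts: "combine l (set_mset (image_mset cotree_graph (parts l T))) = cotree_graph T"
  by (cases T) (auto simp: combine_single)

lemma leaves_parts: "\<Sum>\<^sub># (image_mset leaves (parts l T)) = leaves T"
  by (cases T) auto

lemma combine_Un:
  assumes "pverts (combine l As) \<inter> pverts (combine l Bs) = {}"
  shows "combine l (As \<union> Bs) = combine l {combine l As, combine l Bs}"
proof (cases l)
  case L0
  then show ?thesis by (simp add: graph_union_def)
next
  case L1
  have disj: "pverts A \<inter> pverts B = {}" if "A \<in> As" "B \<in> Bs" for A B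
    using assms that by auto
  have "parcs (graph_join (As \<union> Bs)) =
      parcs (graph_join As) \<union> parcs (graph_join Bs) \<union>
      (\<Union>A \<in> As. pverts A) \<times> (\<Union>B \<in> Bs. pverts B) \<union> (\<Union>B \<in> Bs. pverts B) \<times> (\<Union>A \<in> As. pverts A)"
    (is "?L = ?R")
  proof
    show "?L \<subseteq> ?R" by (auto simp: graph_join_def)
    show "?R \<subseteq> ?L"
    proof
      fix e assume "e \<in> ?R"
      moreover have "e \<in> ?L" if "e \<in> pverts A \<times> pverts B \<or> e \<in> pverts B \<times> pverts A"
          "A \<in> As" "B \<in> Bs" for A B
      proof -
        have "A \<noteq> B" using disj[OF that(2,3)] that(1) by auto
        then show ?thesis using that by (auto simp: graph_join_def)
      qed
      ultimately show "e \<in> ?L" by (auto simp: graph_join_def)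
    qed
  qed
  moreover have pair: "parcs (graph_join {A, B}) =
      parcs A \<union> parcs B \<union> pverts A \<times> pverts B \<union> pverts B \<times> pverts A"
    if "pverts A \<inter> pverts B = {}" for A B :: "'a pair_pre_digraph"
    using that by (cases "A = B") (auto simp: graph_join_def)
  moreover have pv: "pverts (graph_join Gs) = (\<Union>G \<in> Gs. pverts G)"
    for Gs :: "'a pair_pre_digraph set"
    by (simp add: graph_join_def)
  moreover have "pverts (graph_join As) \<inter> pverts (graph_join Bs) = {}" using assms L1 by simp
  ultimately have "parcs (graph_join (As \<union> Bs)) = parcs (graph_join {graph_join As, graph_join Bs})"
    by simp
  moreover have "pverts (graph_join (As \<union> Bs)) = pverts (graph_join {graph_join As, graph_join Bs})"
    by (simp add: pv)
  ultimately show ?thesis unfolding L1 combine.simps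
    by (intro pair_pre_digraph_eqI)
qed

lemma is_cotree_combine:
  assumes "is_cotree S G" "is_cotree T H" "pverts G \<inter> pverts H = {}"
  shows "is_cotree (Node l (parts l S + parts l T)) (combine l {G, H})"
proof -
  have G: "cotree_graph S = G" "cotree_graph T = H" and d: "distinct_leaves S" "distinct_leaves T"
    and p: "proper_cotree S" "proper_cotree T"
    using assms by (auto simp: is_cotree_iff)
  have "cotree_graph (Node l (parts l S + parts l T)) =
      combine l (set_mset (image_mset cotree_graph (parts l S)) \<union>
        set_mset (image_mset cotree_graph (parts l T)))"
    by (simp add: image_Un)
  also have "\<dots> = combine l {G, H}"
    by (subst combine_Un; simp only: combine_parts G assms(3))
  finally have 1: "cotree_graph (Node l (parts l S + parts l T)) = combine l {G, H}" .
  have "set_mset (leaves S) \<inter> set_mset (leaves T) = {}"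
    using assms(3) G pverts_cotree_graph[of S] pverts_cotree_graph[of T] by simp
  then have "count (leaves S) v = 0 \<or> count (leaves T) v = 0" for v
    by (metis disjoint_iff not_in_iff)
  then have 2: "distinct_leaves (Node l (parts l S + parts l T))"
    using d unfolding distinct_leaves_def by (simp add: leaves_parts) (metis add_0 add_0_right)
  have ne: "size (parts l U) \<ge> 1" if "proper_cotree U" for U :: "'a cotree"
    using that by (cases U) (auto simp: proper_cotree_Node)
  have pp: "(\<forall>l' ds. Node l' ds \<in># parts l U \<longrightarrow> l' \<noteq> l) \<and> (\<forall>c \<in># parts l U. proper_cotree c)"
    if "proper_cotree U" for U :: "'a cotree"
    using that by (cases U) (auto simp: proper_cotree_Node)
  have 3: "proper_cotree (Node l (parts l S + parts l T))"
    using ne[OF p(1)] ne[OF p(2)] pp[OF p(1)] pp[OF p(2)] by (auto simp: proper_cotree_Node)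
  from 1 2 3 show ?thesis by (simp add: is_cotree_iff)
qed

theorem cograph_ex1_cotree: "cograph G \<Longrightarrow> \<exists>!T. is_cotree T G"
proof (rule ex_ex1I)
  show "\<exists>T. is_cotree T G" if "cograph G"
    using that
  proof induction
    case (single G)
    then have "card (pverts G) = 1" "parcs G = {(u, v). (u, v) \<in> pverts G \<times> pverts G \<and> u \<noteq> v}"
      using complete_digraph_pair_def[of 1 G] by auto
    moreover from this(1) obtain v where "pverts G = {v}" by (auto simp: card_1_singleton_iff)
    ultimately have "G = \<lparr> pverts = {v}, parcs = {} \<rparr>"
      by (intro pair_pre_digraph_eqI) auto
    then have "is_cotree (Leaf v) G" by (simp add: is_cotree_def)
    then show ?case ..
  next
    case (disjoint_union G H)
    then show ?case using is_cotree_combine[of _ G _ H L0] by auto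
  next
    case (join G H)
    then show ?case using is_cotree_combine[of _ G _ H L1] by auto
  qed
  show "S = T" if "is_cotree S G" "is_cotree T G" for S T
    using that cotree_unique by (auto simp: is_cotree_iff)
qed

corollary is_cotree_cotree_of: "cograph G \<Longrightarrow> is_cotree (cotree_of G) G"
  unfolding cotree_of_def by (rule theI') (rule cograph_ex1_cotree)

end

theory Submission
  imports Defs
begin

text \<open>
  In a well-equi-hued graph \<open>n / \<chi>\<close> is the independence number \<open>\<alpha>\<close> (take \<open>i = 1\<close>), so the property
  says that every maximal \<open>k\<close>-colorable set with \<open>k \<le> \<chi>\<close> has \<open>k \<alpha>\<close> vertices. A set of chromatic
  number \<open>k\<close> has at most \<open>k \<alpha>\<close> vertices, and comparing the total with the sum of these bounds over
  the parts forces equality in each part. Hence a disjoint union is well-equi-hued iff its parts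
  are and they have the same \<open>\<chi>\<close>; a join is well-equi-hued iff its parts are and they have the
  same \<open>\<alpha>\<close>. Along the cotree, \<open>\<chi>\<close> is the sum at joins and the maximum at unions, and \<open>\<alpha>\<close> the other
  way round. As labels alternate, one of the two procedures computes \<open>\<chi>\<close> and the other \<open>\<alpha>\<close>, and
  the uniform assignment property asks for equal \<open>\<chi>\<close> below unions and equal \<open>\<alpha>\<close> below joins.
\<close>

section \<open>Chromatic and independence numbers of vertex sets\<close>

text \<open>One arc relation \<open>E\<close> is kept fixed and induced subgraphs are given by their
  vertex sets alone, so passing to a subgraph never changes \<open>E\<close>.\<close>

definition proper_coloring :: "'a rel \<Rightarrow> 'a set \<Rightarrow> ('a \<Rightarrow> 'b) \<Rightarrow> bool" where
  "proper_coloring E S f \<longleftrightarrow> (\<forall>u \<in> S. \<forall>v \<in> S. (u, v) \<in> E \<longrightarrow> f u \<noteq> f v)"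

definition colorable_set :: "'a rel \<Rightarrow> 'a set \<Rightarrow> nat \<Rightarrow> bool" where
  "colorable_set E S k \<longleftrightarrow> (\<exists>f :: 'a \<Rightarrow> nat. f ` S \<subseteq> {..<k} \<and> proper_coloring E S f)"

definition chi :: "'a rel \<Rightarrow> 'a set \<Rightarrow> nat" where
  "chi E S = (LEAST k. colorable_set E S k)"

text \<open>For finite sets and loop-free \<open>E\<close>, \<open>chi E S \<le> 1\<close> says that
  \<open>S\<close> is independent, with the empty set included; so this is the independence
  number.\<close>

definition alpha :: "'a rel \<Rightarrow> 'a set \<Rightarrow> nat" where
  "alpha E V = Max (card ` {S. S \<subseteq> V \<and> chi E S \<le> 1})"

definition max_colorable_set :: "'a rel \<Rightarrow> 'a set \<Rightarrow> nat \<Rightarrow> 'a set \<Rightarrow> bool" where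
  "max_colorable_set E V k S \<longleftrightarrow>
     S \<subseteq> V \<and> chi E S \<le> k \<and> (\<forall>S'. S \<subset> S' \<and> S' \<subseteq> V \<longrightarrow> k < chi E S')"

text \<open>The division-free form of being well-equi-hued, with \<open>alpha E V\<close> in the
  place of the order divided by the chromatic number. The value k = 0 adds nothing, as only the
  empty set is maximal there, and above \<open>chi E V\<close> only \<open>V\<close> is
  maximal.\<close>

definition equi_hued :: "'a rel \<Rightarrow> 'a set \<Rightarrow> bool" where
  "equi_hued E V \<longleftrightarrow>
     (\<forall>k \<le> chi E V. \<forall>S. max_colorable_set E V k S \<longrightarrow> card S = k * alpha E V)"

lemma equi_huedD:
  "\<lbrakk>equi_hued E V; max_colorable_set E V k S; k \<le> chi E V\<rbrakk> \<Longrightarrow> card S = k * alpha E V"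
  by (simp add: equi_hued_def)

lemma proper_coloring_subset:
  "\<lbrakk>proper_coloring E T f; S \<subseteq> T\<rbrakk> \<Longrightarrow> proper_coloring E S f"
  by (auto simp: proper_coloring_def)

section \<open>Basic facts on \<open>chi\<close>, maximal colorable sets and
  \<open>alpha\<close>\<close>

locale loopfree =
  fixes E :: "'a rel"
  assumes no_loop: "(v, v) \<notin> E"
begin

text \<open>Colors may have any type: the used ones are renumbered by an initial segment. Hence the
  number of colors actually used bounds \<open>chi\<close>.\<close>

lemma colorable_set_card_image:
  fixes f :: "'a \<Rightarrow> 'b"
  assumes "finite S" "proper_coloring E S f"
  shows "colorable_set E S (card (f ` S))"
proof -
  obtain h where h: "bij_betw h (f ` S) {0..<card (f ` S)}"
    using ex_bij_betw_finite_nat assms(1) by blast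
  then have inj: "inj_on h (f ` S)" and im: "h ` f ` S = {0..<card (f ` S)}"
    by (simp_all add: bij_betw_def)
  have "proper_coloring E S (h \<circ> f)"
    using assms(2) by (auto simp: proper_coloring_def inj_on_eq_iff[OF inj])
  moreover have "(h \<circ> f) ` S \<subseteq> {..<card (f ` S)}"
    unfolding image_comp[symmetric] im by auto
  ultimately show ?thesis unfolding colorable_set_def by blast
qed

lemma chi_le_iff:
  assumes "finite S"
  shows "chi E S \<le> k \<longleftrightarrow> colorable_set E S k"
proof
  \<comment> \<open>Giving every vertex its own color shows that the least number in the definition
    of \<open>chi\<close> is attained.\<close>
  have "proper_coloring E S id" using no_loop by (auto simp: proper_coloring_def)
  from colorable_set_card_image[OF assms this] have "colorable_set E S (chi E S)"
    unfolding chi_def by (rule LeastI)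
  then show "colorable_set E S k" if "chi E S \<le> k"
    using that unfolding colorable_set_def by (meson lessThan_subset_iff order_trans)
qed (simp add: chi_def Least_le)

lemma chi_coloring:
  assumes "finite S"
  obtains f :: "'a \<Rightarrow> nat" where "f ` S \<subseteq> {..<chi E S}" "proper_coloring E S f"
  using chi_le_iff[OF assms, of "chi E S"] unfolding colorable_set_def by auto

lemma chi_le_card:
  assumes "finite S" "proper_coloring E S f"
  shows "chi E S \<le> card (f ` S)"
  using colorable_set_card_image[OF assms] chi_le_iff[OF assms(1)] by blast

lemma chi_leI:
  fixes f :: "'a \<Rightarrow> nat"
  assumes "finite S" "f ` S \<subseteq> {..<k}" "proper_coloring E S f"
  shows "chi E S \<le> k"
  using assms chi_le_iff[OF assms(1)] unfolding colorable_set_def by blast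

lemma chi_mono:
  assumes "finite T" "S \<subseteq> T"
  shows "chi E S \<le> chi E T"
proof -
  obtain f :: "'a \<Rightarrow> nat" where "f ` T \<subseteq> {..<chi E T}" "proper_coloring E T f"
    using chi_coloring[OF assms(1)] .
  then show ?thesis
    using assms by (intro chi_leI[of _ f]) (auto intro: finite_subset proper_coloring_subset)
qed

lemma chi_empty [simp]: "chi E {} = 0"
  using chi_leI[of "{}" "\<lambda>_. 0" 0] by (simp add: proper_coloring_def)

lemma chi_pos:
  assumes "finite S" "S \<noteq> {}"
  shows "chi E S > 0"
proof -
  obtain f :: "'a \<Rightarrow> nat" where "f ` S \<subseteq> {..<chi E S}"
    using chi_coloring[OF assms(1)] .
  then show ?thesis using assms(2) by (cases "chi E S = 0") auto
qed

lemma chi_insert: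
  assumes "finite S"
  shows "chi E (insert v S) \<le> Suc (chi E S)"
proof -
  obtain f :: "'a \<Rightarrow> nat" where f: "f ` S \<subseteq> {..<chi E S}" "proper_coloring E S f"
    using chi_coloring[OF assms(1)] .
  show ?thesis
  proof (rule chi_leI)
    show "(f(v := chi E S)) ` insert v S \<subseteq> {..<Suc (chi E S)}"
      using f(1) by (auto simp: less_Suc_eq)
    have "f u < chi E S" if "u \<in> S" for u using f(1) that by auto
    then show "proper_coloring E (insert v S) (f(v := chi E S))"
      using f(2) no_loop by (fastforce simp: proper_coloring_def)
  qed (use assms in simp)
qed

text \<open>As \<open>chi\<close> is monotone, extensions by one vertex decide maximality. A single
  vertex lies in a single part, which is what makes maximality split over unions and joins.\<close>

lemma max_colorable_set_iff:
  assumes "finite V"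
  shows "max_colorable_set E V k S \<longleftrightarrow>
    S \<subseteq> V \<and> chi E S \<le> k \<and> (\<forall>v \<in> V - S. k < chi E (insert v S))"
proof -
  have "(\<forall>S'. S \<subset> S' \<and> S' \<subseteq> V \<longrightarrow> k < chi E S') \<longleftrightarrow> (\<forall>v \<in> V - S. k < chi E (insert v S))"
    if "S \<subseteq> V"
  proof
    assume R: "\<forall>v \<in> V - S. k < chi E (insert v S)"
    show "\<forall>S'. S \<subset> S' \<and> S' \<subseteq> V \<longrightarrow> k < chi E S'"
    proof (intro allI impI)
      fix S' assume S': "S \<subset> S' \<and> S' \<subseteq> V"
      then obtain v where v: "v \<in> S'" "v \<notin> S" by blast
      then have "k < chi E (insert v S)" using R S' by blast
      also have "\<dots> \<le> chi E S'"
        using v S' assms by (intro chi_mono) (auto intro: finite_subset)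
      finally show "k < chi E S'" .
    qed
  qed (use that in blast)
  then show ?thesis unfolding max_colorable_set_def by blast
qed

text \<open>A new vertex raises \<open>chi\<close> by at most one, so a proper subset of
  \<open>V\<close> with fewer than k colors could be enlarged.\<close>

lemma chi_max_colorable_set:
  assumes "finite V" "max_colorable_set E V k S" "k \<le> chi E V"
  shows "chi E S = k"
proof (rule ccontr)
  assume "chi E S \<noteq> k"
  then have less: "chi E S < k" and S: "S \<subseteq> V" "\<forall>v \<in> V - S. k < chi E (insert v S)"
    using assms(1,2) by (auto simp: max_colorable_set_iff)
  then have "S \<noteq> V" using assms(3) by auto
  then obtain v where "v \<in> V - S" using S(1) by blast
  then have "k < chi E (insert v S)" using S by blast
  then show False using chi_insert[of S v] less finite_subset[OF S(1) assms(1)] by linarith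
qed

lemma ex_max_colorable_set:
  assumes "finite V"
  shows "\<exists>S. max_colorable_set E V k S"
proof -
  let ?A = "{S. S \<subseteq> V \<and> chi E S \<le> k}"
  have fin: "finite ?A" using assms by simp
  have empty: "{} \<in> ?A" by simp
  obtain S where S: "S \<in> ?A" and max: "{} \<subseteq> S \<and> (\<forall>S' \<in> ?A. S \<subseteq> S' \<longrightarrow> S = S')"
    using finite_has_maximal2[OF fin empty] by (rule bexE)
  have "k < chi E S'" if "S \<subset> S'" "S' \<subseteq> V" for S'
  proof -
    have "S' \<notin> ?A" using max that(1) by (metis psubset_eq)
    then show ?thesis using that(2) by simp
  qed
  with S have "max_colorable_set E V k S" by (simp add: max_colorable_set_def)
  then show ?thesis ..
qed

lemma max_colorable_set_full:
  assumes "chi E V \<le> k"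
  shows "max_colorable_set E V k S \<longleftrightarrow> S = V"
proof
  show "S = V" if "max_colorable_set E V k S"
    using that assms unfolding max_colorable_set_def by (meson leD order_refl psubset_eq)
qed (use assms in \<open>auto simp: max_colorable_set_def\<close>)

lemma max_colorable_set_0:
  assumes "finite V"
  shows "max_colorable_set E V 0 S \<longleftrightarrow> S = {}"
proof -
  have "S = {}" if "S \<subseteq> V" "chi E S \<le> 0"
    using chi_pos[of S] that finite_subset[OF that(1) assms] by auto
  moreover have "0 < chi E {v}" for v by (rule chi_pos) auto
  ultimately show ?thesis unfolding max_colorable_set_iff[OF assms] by auto
qed

lemma card_le_alpha:
  assumes "finite V" "S \<subseteq> V" "chi E S \<le> 1"
  shows "card S \<le> alpha E V"
  unfolding alpha_def using assms by (intro Max_ge) auto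

lemma alpha_attained:
  assumes "finite V"
  obtains S where "S \<subseteq> V" "chi E S \<le> 1" "card S = alpha E V"
proof -
  have "finite {S. S \<subseteq> V \<and> chi E S \<le> 1}" using assms by auto
  moreover have "{} \<in> {S. S \<subseteq> V \<and> chi E S \<le> 1}" by simp
  ultimately have "alpha E V \<in> card ` {S. S \<subseteq> V \<and> chi E S \<le> 1}"
    unfolding alpha_def by (intro Max_in) auto
  then obtain S where "S \<in> {S. S \<subseteq> V \<and> chi E S \<le> 1}" "alpha E V = card S" by (elim imageE)
  then show ?thesis using that[of S] by simp
qed

lemma alpha_mono:
  assumes "finite V" "U \<subseteq> V"
  shows "alpha E U \<le> alpha E V"
proof -
  obtain S where "S \<subseteq> U" "chi E S \<le> 1" "card S = alpha E U"
    using alpha_attained[OF finite_subset[OF assms(2,1)]] .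
  then show ?thesis using card_le_alpha[of V S] assms by auto
qed

lemma chi_singleton [simp]: "chi E {v} = 1"
  using chi_insert[of "{}" v] chi_pos[of "{v}"] by simp

lemma alpha_pos:
  assumes "finite V" "V \<noteq> {}"
  shows "alpha E V > 0"
proof -
  obtain v where "v \<in> V" using assms(2) by blast
  then show ?thesis using card_le_alpha[of V "{v}"] assms(1) by auto
qed

lemma alpha_singleton [simp]: "alpha E {v} = 1"
proof -
  obtain S where "S \<subseteq> {v}" "chi E S \<le> 1" "card S = alpha E {v}"
    using alpha_attained[of "{v}"] by blast
  then have "alpha E {v} \<le> 1" using card_mono[of "{v}" S] by simp
  then show ?thesis using alpha_pos[of "{v}"] by simp
qed

text \<open>Ties \<open>alpha\<close> to the case k = 1: an independent set of largest size cannot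
  be enlarged.\<close>

lemma alpha_max_colorable_set:
  assumes "finite V"
  obtains S where "max_colorable_set E V 1 S" "card S = alpha E V"
proof -
  obtain S where S: "S \<subseteq> V" "chi E S \<le> 1" "card S = alpha E V"
    using alpha_attained[OF assms] .
  have "1 < chi E (insert v S)" if "v \<in> V - S" for v
  proof (rule ccontr)
    assume "\<not> 1 < chi E (insert v S)"
    then have "card (insert v S) \<le> alpha E V" using card_le_alpha[OF assms] S(1) that by auto
    then show False using S(1,3) that finite_subset[OF S(1) assms] by simp
  qed
  then show ?thesis using that[of S] S assms by (auto simp: max_colorable_set_iff)
qed

text \<open>Each of the \<open>chi E S\<close> color classes is independent.\<close>

lemma card_le_chi_alpha:
  assumes "finite V" "S \<subseteq> V"
  shows "card S \<le> chi E S * alpha E V"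
proof -
  have fin: "finite S" using assms finite_subset by blast
  obtain f :: "'a \<Rightarrow> nat" where f: "f ` S \<subseteq> {..<chi E S}" "proper_coloring E S f"
    using chi_coloring[OF fin] .
  have "card {v \<in> S. f v = i} \<le> alpha E V" for i
  proof (rule card_le_alpha[OF assms(1)])
    have "(u, v) \<notin> E" if "u \<in> S" "v \<in> S" "f u = f v" for u v
      using f(2) that by (auto simp: proper_coloring_def)
    then have "proper_coloring E {v \<in> S. f v = i} (\<lambda>_. 0 :: nat)"
      by (simp add: proper_coloring_def)
    then show "chi E {v \<in> S. f v = i} \<le> 1" using fin by (intro chi_leI) auto
  qed (use assms in auto)
  then have "(\<Sum>i<chi E S. card {v \<in> S. f v = i}) \<le> chi E S * alpha E V"
    using sum_bounded_above[of "{..<chi E S}" _ "alpha E V"] by simp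
  moreover have "card (\<Union>i<chi E S. {v \<in> S. f v = i}) \<le> (\<Sum>i<chi E S. card {v \<in> S. f v = i})"
    by (rule card_UN_le) simp
  moreover have "(\<Union>i<chi E S. {v \<in> S. f v = i}) = S" using f(1) by auto
  ultimately show ?thesis by simp
qed

text \<open>Upper bound: the colors of \<open>B\<close> are shifted past those of \<open>A\<close>.
  Lower bound: no color can occur on both sides.\<close>

lemma chi_Un_joined:
  assumes "finite A" "finite B" "\<And>u v. u \<in> A \<Longrightarrow> v \<in> B \<Longrightarrow> (u, v) \<in> E \<and> (v, u) \<in> E"
  shows "chi E (A \<union> B) = chi E A + chi E B"
proof (rule antisym)
  obtain f :: "'a \<Rightarrow> nat" where f: "f ` A \<subseteq> {..<chi E A}" "proper_coloring E A f"
    using chi_coloring[OF assms(1)] .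
  obtain g :: "'a \<Rightarrow> nat" where g: "g ` B \<subseteq> {..<chi E B}" "proper_coloring E B g"
    using chi_coloring[OF assms(2)] .
  \<comment> \<open>A common vertex would be joined to itself.\<close>
  have disj: "v \<notin> A" if "v \<in> B" for v using assms(3)[of v v] that no_loop by auto
  let ?h = "\<lambda>v. if v \<in> A then f v else chi E A + g v"
  show "chi E (A \<union> B) \<le> chi E A + chi E B"
  proof (rule chi_leI)
    show "?h ` (A \<union> B) \<subseteq> {..<chi E A + chi E B}"
      using f(1) g(1) disj by fastforce
    have "f u \<noteq> chi E A + n" "chi E A + n \<noteq> f u" if "u \<in> A" for u n
      using f(1) that by auto
    then show "proper_coloring E (A \<union> B) ?h"
      using f(2) g(2) disj unfolding proper_coloring_def by simp_all blast+
  qed (use assms in simp)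
next
  have fin: "finite (A \<union> B)" using assms by simp
  obtain f :: "'a \<Rightarrow> nat" where f: "f ` (A \<union> B) \<subseteq> {..<chi E (A \<union> B)}"
    "proper_coloring E (A \<union> B) f"
    using chi_coloring[OF fin] .
  have "f ` A \<inter> f ` B = {}" using f(2) assms(3) unfolding proper_coloring_def by fastforce
  then have "card (f ` A) + card (f ` B) = card (f ` (A \<union> B))"
    using assms by (simp add: card_Un_disjoint image_Un)
  also have "\<dots> \<le> chi E (A \<union> B)" using card_mono[OF _ f(1)] by simp
  moreover have "chi E A \<le> card (f ` A)" "chi E B \<le> card (f ` B)"
    using f(2) assms by (auto intro!: chi_le_card elim: proper_coloring_subset)
  ultimately show "chi E A + chi E B \<le> chi E (A \<union> B)" by linarith
qed

lemma equi_hued_singleton: "equi_hued E {v}"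
  unfolding equi_hued_def
proof (intro allI impI)
  fix k S assume k: "k \<le> chi E {v}" "max_colorable_set E {v} k S"
  then have "k = 0 \<or> k = 1" by auto
  then show "card S = k * alpha E {v}"
    using k max_colorable_set_0[of "{v}" S] max_colorable_set_full[of "{v}" 1 S] by auto
qed

end

section \<open>Unions and joins of vertex sets\<close>

text \<open>The index type is arbitrary so that the children of a cotree node can serve as indices.
  A nonempty \<open>I\<close> makes maxima over the parts meaningful, and nonempty parts have
  positive \<open>chi\<close> and \<open>alpha\<close>.\<close>

locale vertex_partition = loopfree E for E :: "'a rel" +
  fixes I :: "'i set" and P :: "'i \<Rightarrow> 'a set"
  assumes finite_index: "finite I" and index_nonempty: "I \<noteq> {}"
    and finite_part: "i \<in> I \<Longrightarrow> finite (P i)"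
    and part_nonempty: "i \<in> I \<Longrightarrow> P i \<noteq> {}"
    and parts_disjoint: "\<lbrakk>i \<in> I; j \<in> I; i \<noteq> j\<rbrakk> \<Longrightarrow> P i \<inter> P j = {}"
begin

definition V :: "'a set" where
  "V = (\<Union>i \<in> I. P i)"

lemma finite_V: "finite V"
  using finite_index finite_part by (auto simp: V_def)

lemma finite_subset_V: "S \<subseteq> V \<Longrightarrow> finite S"
  using finite_V finite_subset by blast

lemma part_subset: "i \<in> I \<Longrightarrow> P i \<subseteq> V"
  by (auto simp: V_def)

lemma split_subset: "S \<subseteq> V \<Longrightarrow> S = (\<Union>i \<in> I. S \<inter> P i)"
  by (auto simp: V_def)

text \<open>Sets chosen part by part are recovered as the traces of their union; subsets of
  \<open>V\<close> with prescribed traces are built this way.\<close>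

lemma glue_Int:
  assumes "\<And>i. i \<in> I \<Longrightarrow> A i \<subseteq> P i" "i \<in> I"
  shows "(\<Union>i \<in> I. A i) \<inter> P i = A i"
proof -
  have "A j \<inter> P i = {}" if "j \<in> I" "j \<noteq> i" for j
    using assms(1)[OF that(1)] parts_disjoint[OF that(1) assms(2) that(2)] by blast
  then show ?thesis using assms by blast
qed

lemma glue_subset: "(\<And>i. i \<in> I \<Longrightarrow> A i \<subseteq> P i) \<Longrightarrow> (\<Union>i \<in> I. A i) \<subseteq> V"
  by (auto simp: V_def)

lemma insert_Int_same: "insert v S \<inter> P i = insert v (S \<inter> P i)" if "v \<in> P i"
  using that by auto

lemma insert_Int_other:
  assumes "i \<in> I" "j \<in> I" "i \<noteq> j" "v \<in> P i"
  shows "insert v S \<inter> P j = S \<inter> P j"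
  using parts_disjoint[OF assms(1-3)] assms(4) by auto

lemma card_split:
  assumes "S \<subseteq> V"
  shows "card S = (\<Sum>i \<in> I. card (S \<inter> P i))"
proof -
  have "card (\<Union>i \<in> I. S \<inter> P i) = (\<Sum>i \<in> I. card (S \<inter> P i))"
    using finite_index finite_part parts_disjoint by (intro card_UN_disjoint) auto
  then show ?thesis using split_subset[OF assms] by simp
qed

end

section \<open>Disjoint unions\<close>

locale vertex_union = vertex_partition E I P for E :: "'a rel" and I :: "'i set" and P +
  assumes no_cross: "\<lbrakk>i \<in> I; j \<in> I; i \<noteq> j; u \<in> P i; v \<in> P j\<rbrakk> \<Longrightarrow> (u, v) \<notin> E"
begin

lemma chi_union_le_iff:
  assumes "S \<subseteq> V"
  shows "chi E S \<le> k \<longleftrightarrow> (\<forall>i \<in> I. chi E (S \<inter> P i) \<le> k)"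
proof
  assume "chi E S \<le> k"
  then show "\<forall>i \<in> I. chi E (S \<inter> P i) \<le> k"
    using chi_mono[OF finite_subset_V[OF assms], of "S \<inter> P _"] by (meson inf_le1 order_trans)
next
  assume R: "\<forall>i \<in> I. chi E (S \<inter> P i) \<le> k"
  have "\<exists>f :: 'a \<Rightarrow> nat. f ` (S \<inter> P i) \<subseteq> {..<k} \<and> proper_coloring E (S \<inter> P i) f"
    if "i \<in> I" for i
    using R that chi_le_iff[of "S \<inter> P i" k] finite_part unfolding colorable_set_def by auto
  then obtain f :: "'i \<Rightarrow> 'a \<Rightarrow> nat"
    where f: "\<And>i. i \<in> I \<Longrightarrow> f i ` (S \<inter> P i) \<subseteq> {..<k} \<and> proper_coloring E (S \<inter> P i) (f i)"
    by metis
  \<comment> \<open>\<open>p v\<close> is the part containing \<open>v\<close>. No arc leaves a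
    part, so both ends of an arc are colored by the same \<open>f i\<close>, and the parts can share
    the k colors.\<close>
  have "\<exists>i. v \<in> S \<longrightarrow> i \<in> I \<and> v \<in> P i" for v using assms by (auto simp: V_def)
  then obtain p where p: "\<And>v. v \<in> S \<Longrightarrow> p v \<in> I \<and> v \<in> P (p v)" by metis
  show "chi E S \<le> k"
  proof (rule chi_leI)
    show "(\<lambda>v. f (p v) v) ` S \<subseteq> {..<k}" using f p by blast
    show "proper_coloring E S (\<lambda>v. f (p v) v)"
      unfolding proper_coloring_def
    proof (intro ballI impI)
      fix u v assume uv: "u \<in> S" "v \<in> S" "(u, v) \<in> E"
      then have "p u = p v" using no_cross[of "p u" "p v" u v] p by blast
      then show "f (p u) u \<noteq> f (p v) v"
        using f[of "p v"] uv p[of u] p[of v] by (auto simp: proper_coloring_def)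
    qed
  qed (use assms finite_subset_V in blast)
qed

text \<open>All parts use the same k colors. Adding a vertex changes the trace on one part only, and
  the other traces stay within k colors.\<close>

lemma max_colorable_union_iff:
  assumes "S \<subseteq> V"
  shows "max_colorable_set E V k S \<longleftrightarrow> (\<forall>i \<in> I. max_colorable_set E (P i) k (S \<inter> P i))"
proof -
  have "k < chi E (insert v S) \<longleftrightarrow> k < chi E (insert v (S \<inter> P i))"
    if le: "chi E S \<le> k" and v: "i \<in> I" "v \<in> P i" for v i
  proof -
    have "insert v S \<subseteq> V" using assms v by (auto simp: V_def)
    then have "chi E (insert v S) \<le> k \<longleftrightarrow> (\<forall>j \<in> I. chi E (insert v S \<inter> P j) \<le> k)"
      by (rule chi_union_le_iff)
    also have "\<dots> \<longleftrightarrow> chi E (insert v (S \<inter> P i)) \<le> k"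
    proof -
      have "chi E (insert v S \<inter> P j) \<le> k" if "j \<in> I" "j \<noteq> i" for j
        using insert_Int_other[OF v(1) that(1) _ v(2)] that le chi_union_le_iff[OF assms] by auto
      then show ?thesis using insert_Int_same[OF v(2), of S] v(1) by metis
    qed
    finally show ?thesis by linarith
  qed
  then have "(\<forall>v \<in> V - S. k < chi E (insert v S)) \<longleftrightarrow>
      (\<forall>i \<in> I. \<forall>v \<in> P i - S \<inter> P i. k < chi E (insert v (S \<inter> P i)))"
    if "chi E S \<le> k"
    using that by (simp add: V_def) blast
  then show ?thesis
    using assms chi_union_le_iff[OF assms, of k]
    by (simp add: max_colorable_set_iff[OF finite_V] max_colorable_set_iff[OF finite_part]) blast
qed

lemma chi_union: "chi E V = Max ((\<lambda>i. chi E (P i)) ` I)"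
proof -
  have "V \<inter> P i = P i" if "i \<in> I" for i using that part_subset by blast
  \<comment> \<open>Both numbers have the same upper bounds, hence they are equal.\<close>
  then have "chi E V \<le> k \<longleftrightarrow> Max ((\<lambda>i. chi E (P i)) ` I) \<le> k" for k
    using chi_union_le_iff[of V k] finite_index index_nonempty by simp
  then show ?thesis by (metis order_antisym order_refl)
qed

lemma alpha_union: "alpha E V = (\<Sum>i \<in> I. alpha E (P i))"
proof (rule antisym)
  obtain S where S: "S \<subseteq> V" "chi E S \<le> 1" "card S = alpha E V"
    using alpha_attained[OF finite_V] .
  have "card (S \<inter> P i) \<le> alpha E (P i)" if "i \<in> I" for i
    using chi_union_le_iff[OF S(1), of 1] S(2) that finite_part by (intro card_le_alpha) auto
  then show "alpha E V \<le> (\<Sum>i \<in> I. alpha E (P i))"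
    unfolding S(3)[symmetric] card_split[OF S(1)] by (intro sum_mono)
next
  have "\<forall>i \<in> I. \<exists>S. S \<subseteq> P i \<and> chi E S \<le> 1 \<and> card S = alpha E (P i)"
    using alpha_attained finite_part by metis
  then obtain A where A: "\<And>i. i \<in> I \<Longrightarrow> A i \<subseteq> P i"
    "\<And>i. i \<in> I \<Longrightarrow> chi E (A i) \<le> 1 \<and> card (A i) = alpha E (P i)" by metis
  let ?S = "\<Union>i \<in> I. A i"
  have "chi E ?S \<le> 1" using chi_union_le_iff[OF glue_subset] glue_Int A by simp
  then have "card ?S \<le> alpha E V" using glue_subset A by (intro card_le_alpha[OF finite_V]) auto
  moreover have "card ?S = (\<Sum>i \<in> I. alpha E (P i))"
    using card_split[OF glue_subset] glue_Int A by simp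
  ultimately show "(\<Sum>i \<in> I. alpha E (P i)) \<le> alpha E V" by simp
qed

lemma equi_hued_union:
  "equi_hued E V \<longleftrightarrow>
     (\<forall>i \<in> I. equi_hued E (P i)) \<and> (\<forall>i \<in> I. \<forall>j \<in> I. chi E (P i) = chi E (P j))"
proof (intro iffI)
  assume R: "(\<forall>i \<in> I. equi_hued E (P i)) \<and> (\<forall>i \<in> I. \<forall>j \<in> I. chi E (P i) = chi E (P j))"
  have "chi E V \<in> (\<lambda>i. chi E (P i)) ` I"
    unfolding chi_union using finite_index index_nonempty by (intro Max_in) auto
  then obtain j where "j \<in> I" "chi E V = chi E (P j)" by (elim imageE)
  then have chi: "chi E (P i) = chi E V" if "i \<in> I" for i
    using R that by metis
  show "equi_hued E V"
    unfolding equi_hued_def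
  proof (intro allI impI)
    fix k S assume k: "k \<le> chi E V" "max_colorable_set E V k S"
    then have S: "S \<subseteq> V" by (simp add: max_colorable_set_def)
    have "card (S \<inter> P i) = k * alpha E (P i)" if "i \<in> I" for i
    proof -
      have "max_colorable_set E (P i) k (S \<inter> P i)"
        using max_colorable_union_iff[OF S] k(2) that by blast
      moreover have "k \<le> chi E (P i)" using k(1) chi[OF that] by simp
      ultimately show ?thesis using equi_huedD R that by metis
    qed
    then show "card S = k * alpha E V"
      by (simp add: card_split[OF S] alpha_union sum_distrib_left)
  qed
next
  assume L: "equi_hued E V"
  have chi_le: "chi E (P i) \<le> chi E V" if "i \<in> I" for i
    using that chi_mono[OF finite_V part_subset] by blast
  have chi: "chi E (P i) = chi E V" if i: "i \<in> I" for i
  proof -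
    \<comment> \<open>For k = \<open>chi E V\<close> the only maximal set is \<open>V\<close>, so
      the total is known. Summed over the parts, the bounds \<open>chi E V * alpha E (P i)\<close>
      give exactly this total, so each is attained. Since already
      \<open>chi E (P i) * alpha E (P i)\<close> bounds \<open>card (P i)\<close>, cancelling the
      positive \<open>alpha E (P i)\<close> gives the claim.\<close>
    have "card V = chi E V * alpha E V"
      using equi_huedD[OF L] max_colorable_set_full[of V "chi E V" V] by simp
    then have "(\<Sum>i \<in> I. card (P i)) = (\<Sum>i \<in> I. chi E V * alpha E (P i))"
      using card_split[of V] part_subset
      by (simp add: alpha_union sum_distrib_left Int_absorb1 cong: sum.cong)
    moreover have le: "card (P i) \<le> chi E (P i) * alpha E (P i)" if "i \<in> I" for i
      using card_le_chi_alpha finite_part that by blast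
    have "card (P i) \<le> chi E V * alpha E (P i)" if "i \<in> I" for i
      using le[OF that] chi_le[OF that] by (meson le_trans mult_le_mono1)
    ultimately have "card (P i) = chi E V * alpha E (P i)"
      using sum_mono_inv[of "\<lambda>i. card (P i)" I "\<lambda>i. chi E V * alpha E (P i)" i] i finite_index
      by blast
    then have "chi E V * alpha E (P i) \<le> chi E (P i) * alpha E (P i)" using le[OF i] by simp
    then show ?thesis
      using alpha_pos finite_part part_nonempty chi_le i by (simp add: order_antisym)
  qed
  moreover have "equi_hued E (P i)" if i: "i \<in> I" for i
    unfolding equi_hued_def
  proof (intro allI impI)
    fix k S assume k: "k \<le> chi E (P i)" "max_colorable_set E (P i) k S"
    \<comment> \<open>To test \<open>S\<close> in part \<open>i\<close>, it is completed by
      arbitrary maximal k-colorable sets of the other parts. The union is maximal in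
      \<open>V\<close>, so its size is known, and all the bounds \<open>k * alpha E (P j)\<close> on
      the pieces must be attained.\<close>
    define A where "A j = (if j = i then S else SOME T. max_colorable_set E (P j) k T)" for j
    have A: "max_colorable_set E (P j) k (A j)" if "j \<in> I" for j
      using someI_ex[OF ex_max_colorable_set[OF finite_part[OF that], of k]] k(2)
      by (simp add: A_def)
    then have sub: "A j \<subseteq> P j" if "j \<in> I" for j using that by (simp add: max_colorable_set_def)
    let ?T = "\<Union>j \<in> I. A j"
    have T: "?T \<subseteq> V" "\<And>j. j \<in> I \<Longrightarrow> ?T \<inter> P j = A j"
      by (rule glue_subset glue_Int, rule sub, assumption+)+
    have "max_colorable_set E V k ?T" using max_colorable_union_iff[OF T(1)] T(2) A by simp
    then have "card ?T = k * alpha E V" using equi_huedD[OF L] k(1) chi i by simp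
    moreover have "card ?T = (\<Sum>j \<in> I. card (A j))" by (simp add: card_split[OF T(1)] T(2))
    ultimately have "(\<Sum>j \<in> I. card (A j)) = (\<Sum>j \<in> I. k * alpha E (P j))"
      by (simp add: alpha_union sum_distrib_left)
    moreover have "card (A j) \<le> k * alpha E (P j)" if "j \<in> I" for j
    proof -
      have "card (A j) \<le> chi E (A j) * alpha E (P j)"
        by (rule card_le_chi_alpha[OF finite_part[OF that] sub[OF that]])
      also have "\<dots> \<le> k * alpha E (P j)"
        using A[OF that] by (simp add: max_colorable_set_def)
      finally show ?thesis .
    qed
    ultimately have "card (A i) = k * alpha E (P i)"
      using sum_mono_inv[of "\<lambda>j. card (A j)" I "\<lambda>j. k * alpha E (P j)" i] i finite_index by blast
    then show "card S = k * alpha E (P i)" by (simp add: A_def)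
  qed
  ultimately show "(\<forall>i \<in> I. equi_hued E (P i)) \<and> (\<forall>i \<in> I. \<forall>j \<in> I. chi E (P i) = chi E (P j))"
    by simp
qed

end

section \<open>Joins\<close>

locale vertex_join = vertex_partition E I P for E :: "'a rel" and I :: "'i set" and P +
  assumes cross: "\<lbrakk>i \<in> I; j \<in> I; i \<noteq> j; u \<in> P i; v \<in> P j\<rbrakk> \<Longrightarrow> (u, v) \<in> E"
begin

lemma chi_join:
  assumes "S \<subseteq> V"
  shows "chi E S = (\<Sum>i \<in> I. chi E (S \<inter> P i))"
proof -
  have "chi E (\<Union>i \<in> J. S \<inter> P i) = (\<Sum>i \<in> J. chi E (S \<inter> P i))" if "finite J" "J \<subseteq> I" for J
    using that
  proof induction
    case (insert j J)
    have "chi E (S \<inter> P j \<union> (\<Union>i \<in> J. S \<inter> P i)) = chi E (S \<inter> P j) + chi E (\<Union>i \<in> J. S \<inter> P i)"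
    proof (rule chi_Un_joined)
      fix u v assume "u \<in> S \<inter> P j" "v \<in> (\<Union>i \<in> J. S \<inter> P i)"
      then obtain i where "i \<in> J" "v \<in> P i" "u \<in> P j" by blast
      then show "(u, v) \<in> E \<and> (v, u) \<in> E"
        using insert.hyps insert.prems by (auto intro: cross)
    qed (use insert finite_part in auto)
    then show ?case using insert by simp
  qed simp
  from this[OF finite_index] show ?thesis using split_subset[OF assms] by simp
qed

text \<open>The parts share no colors, so each trace is measured against its own chromatic number
  and these numbers add up. A new vertex changes one summand only.\<close>

lemma max_colorable_join_iff:
  assumes "S \<subseteq> V"
  shows "max_colorable_set E V (chi E S) S \<longleftrightarrow>
    (\<forall>i \<in> I. max_colorable_set E (P i) (chi E (S \<inter> P i)) (S \<inter> P i))"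
proof -
  have "chi E S < chi E (insert v S) \<longleftrightarrow> chi E (S \<inter> P i) < chi E (insert v (S \<inter> P i))"
    if v: "i \<in> I" "v \<in> P i" for v i
  proof -
    have "insert v S \<subseteq> V" using assms v by (auto simp: V_def)
    then have "chi E (insert v S) = (\<Sum>j \<in> I. chi E (insert v S \<inter> P j))" by (rule chi_join)
    also have "\<dots> = chi E (insert v (S \<inter> P i)) + (\<Sum>j \<in> I - {i}. chi E (insert v S \<inter> P j))"
      by (simp add: sum.remove[OF finite_index v(1)] insert_Int_same[OF v(2)])
    also have "(\<Sum>j \<in> I - {i}. chi E (insert v S \<inter> P j)) = (\<Sum>j \<in> I - {i}. chi E (S \<inter> P j))"
      using insert_Int_other[OF v(1) _ _ v(2)] by (intro sum.cong) auto
    finally show ?thesis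
      by (simp add: chi_join[OF assms] sum.remove[OF finite_index v(1)])
  qed
  then have "(\<forall>v \<in> V - S. chi E S < chi E (insert v S)) \<longleftrightarrow>
      (\<forall>i \<in> I. \<forall>v \<in> P i - S \<inter> P i. chi E (S \<inter> P i) < chi E (insert v (S \<inter> P i)))"
    by (simp add: V_def) blast
  then show ?thesis using assms
    by (simp add: max_colorable_set_iff[OF finite_V] max_colorable_set_iff[OF finite_part])
qed

text \<open>Vertices of different parts are adjacent, so an independent set lies within one
  part.\<close>

lemma alpha_join: "alpha E V = Max ((\<lambda>i. alpha E (P i)) ` I)"
proof (rule antisym)
  obtain S where S: "S \<subseteq> V" "chi E S \<le> 1" "card S = alpha E V"
    using alpha_attained[OF finite_V] .
  have "V \<noteq> {}" using index_nonempty part_nonempty by (auto simp: V_def)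
  then have "S \<noteq> {}" using S(3) alpha_pos[OF finite_V] by auto
  then obtain v where "v \<in> S" by blast
  then obtain i where v: "v \<in> S" "i \<in> I" "v \<in> P i" using S(1) unfolding V_def by blast
  obtain f :: "'a \<Rightarrow> nat" where f: "f ` S \<subseteq> {..<chi E S}" "proper_coloring E S f"
    using chi_coloring[OF finite_subset_V[OF S(1)]] .
  \<comment> \<open>With at most one color everything is colored 0, so an arc inside
    \<open>S\<close> would join equal colors.\<close>
  have f0: "f x = 0" if "x \<in> S" for x using f(1) that S(2) by fastforce
  have "S \<subseteq> P i"
  proof
    fix w assume w: "w \<in> S"
    then obtain j where j: "j \<in> I" "w \<in> P j" using S(1) by (auto simp: V_def)
    have "(v, w) \<notin> E" using f(2) f0 v(1) w unfolding proper_coloring_def by metis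
    then have "j = i" using cross[OF v(2) j(1) _ v(3) j(2)] by blast
    then show "w \<in> P i" using j by simp
  qed
  then have "alpha E V \<le> alpha E (P i)"
    using card_le_alpha[OF finite_part[OF v(2)] _ S(2)] S(3) by simp
  also have "\<dots> \<le> Max ((\<lambda>i. alpha E (P i)) ` I)" using finite_index v(2) by simp
  finally show "alpha E V \<le> Max ((\<lambda>i. alpha E (P i)) ` I)" .
qed (use finite_index index_nonempty alpha_mono[OF finite_V part_subset] in simp)

lemma equi_hued_join:
  "equi_hued E V \<longleftrightarrow>
     (\<forall>i \<in> I. equi_hued E (P i)) \<and> (\<forall>i \<in> I. \<forall>j \<in> I. alpha E (P i) = alpha E (P j))"
proof (intro iffI)
  assume R: "(\<forall>i \<in> I. equi_hued E (P i)) \<and> (\<forall>i \<in> I. \<forall>j \<in> I. alpha E (P i) = alpha E (P j))"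
  have "alpha E V \<in> (\<lambda>i. alpha E (P i)) ` I"
    unfolding alpha_join using finite_index index_nonempty by (intro Max_in) auto
  then obtain j where "j \<in> I" "alpha E V = alpha E (P j)" by (elim imageE)
  then have alpha: "alpha E (P i) = alpha E V" if "i \<in> I" for i
    using R that by metis
  show "equi_hued E V"
    unfolding equi_hued_def
  proof (intro allI impI)
    fix k S assume k: "k \<le> chi E V" "max_colorable_set E V k S"
    then have S: "S \<subseteq> V" by (simp add: max_colorable_set_def)
    \<comment> \<open>\<open>max_colorable_join_iff\<close> is about \<open>chi E S\<close>, so all
      k colors have to be in use.\<close>
    have chi: "chi E S = k" using chi_max_colorable_set[OF finite_V k(2,1)] .
    have "card (S \<inter> P i) = chi E (S \<inter> P i) * alpha E V" if "i \<in> I" for i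
    proof -
      have "max_colorable_set E (P i) (chi E (S \<inter> P i)) (S \<inter> P i)"
        using max_colorable_join_iff[OF S] k(2) chi that by blast
      moreover have "chi E (S \<inter> P i) \<le> chi E (P i)"
        using chi_mono[OF finite_part[OF that]] by blast
      ultimately show ?thesis using equi_huedD R that alpha[OF that] by metis
    qed
    then show "card S = k * alpha E V"
      by (simp add: card_split[OF S] chi_join[OF S] flip: sum_distrib_right chi)
  qed
next
  assume L: "equi_hued E V"
  have equi: "card S = chi E S * alpha E V"
    if "S \<subseteq> V" "\<And>i. i \<in> I \<Longrightarrow> max_colorable_set E (P i) (chi E (S \<inter> P i)) (S \<inter> P i)" for S
    using equi_huedD[OF L] max_colorable_join_iff[OF that(1)] that
      chi_mono[OF finite_V that(1)] by blast
  have alpha: "alpha E (P i) = alpha E V" if i: "i \<in> I" for i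
  proof -
    obtain S where S: "max_colorable_set E (P i) 1 S" "card S = alpha E (P i)"
      using alpha_max_colorable_set[OF finite_part[OF i]] .
    have sub: "S \<subseteq> P i" using S by (simp add: max_colorable_set_def)
    have chi: "chi E S = 1"
      using chi_max_colorable_set[OF finite_part[OF i] S(1)]
        chi_pos[OF finite_part[OF i] part_nonempty[OF i]] by simp
    \<comment> \<open>A maximum independent set of part \<open>i\<close> has an empty trace
      elsewhere, and the empty set is maximal 0-colorable. Hence it is maximal in all of
      \<open>V\<close>.\<close>
    have "max_colorable_set E (P j) (chi E (S \<inter> P j)) (S \<inter> P j)" if "j \<in> I" for j
    proof (cases "j = i")
      case True
      then show ?thesis using S(1) chi sub by (simp add: Int_absorb2)
    next
      case False
      then have "S \<inter> P j = {}" using parts_disjoint[OF i that] sub by blast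
      then show ?thesis using max_colorable_set_0[OF finite_part[OF that]] by simp
    qed
    then have "card S = chi E S * alpha E V" using equi part_subset[OF i] sub by blast
    then show ?thesis using S(2) chi by simp
  qed
  moreover have "equi_hued E (P i)" if i: "i \<in> I" for i
    unfolding equi_hued_def
  proof (intro allI impI)
    fix k S assume k: "k \<le> chi E (P i)" "max_colorable_set E (P i) k S"
    have chi: "chi E S = k" using chi_max_colorable_set[OF finite_part[OF i] k(2,1)] .
    \<comment> \<open>The other parts are taken whole, each being maximal for its own chromatic
      number. The size of the union is then known, which forces equality in the bound on every
      piece.\<close>
    define A where "A = P(i := S)"
    have A: "max_colorable_set E (P j) (chi E (A j)) (A j)" if "j \<in> I" for j
      using k(2) chi max_colorable_set_full[of "P j"] by (simp add: A_def)
    then have sub: "A j \<subseteq> P j" if "j \<in> I" for j using that by (simp add: max_colorable_set_def)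
    let ?T = "\<Union>j \<in> I. A j"
    have T: "?T \<subseteq> V" "\<And>j. j \<in> I \<Longrightarrow> ?T \<inter> P j = A j"
      by (rule glue_subset glue_Int, rule sub, assumption+)+
    have "card ?T = chi E ?T * alpha E V" using equi[OF T(1)] T(2) A by simp
    moreover have "card ?T = (\<Sum>j \<in> I. card (A j))" by (simp add: card_split[OF T(1)] T(2))
    moreover have "chi E ?T = (\<Sum>j \<in> I. chi E (A j))" by (simp add: chi_join[OF T(1)] T(2))
    ultimately have "(\<Sum>j \<in> I. card (A j)) = (\<Sum>j \<in> I. chi E (A j) * alpha E V)"
      by (simp add: sum_distrib_right)
    moreover have "card (A j) \<le> chi E (A j) * alpha E V" if "j \<in> I" for j
      using card_le_chi_alpha[OF finite_part[OF that] sub[OF that]] alpha[OF that] by simp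
    ultimately have "card (A i) = chi E (A i) * alpha E V"
      using sum_mono_inv[of "\<lambda>j. card (A j)" I "\<lambda>j. chi E (A j) * alpha E V" i] i finite_index
      by blast
    then show "card S = k * alpha E (P i)" using chi alpha[OF i] by (simp add: A_def)
  qed
  ultimately show "(\<forall>i \<in> I. equi_hued E (P i)) \<and> (\<forall>i \<in> I. \<forall>j \<in> I. alpha E (P i) = alpha E (P j))"
    by simp
qed

end

section \<open>Values of cotree nodes\<close>

text \<open>Parity of the distance is replaced by the label at which sums are taken, so the value
  depends on the subtree alone. It will turn out that \<open>L1\<close> yields \<open>chi\<close>
  and \<open>L0\<close> yields \<open>alpha\<close>.\<close>

primrec label_value :: "node_label \<Rightarrow> 'a cotree \<Rightarrow> nat" where
  "label_value l (Leaf v) = 1"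
| "label_value l (Node l' cs) =
     (if l' = l then \<Sum>\<^sub># (image_mset (label_value l) cs)
      else Max (set_mset (image_mset (label_value l) cs)))"

definition label_uniform :: "'a cotree \<Rightarrow> bool" where
  "label_uniform T \<longleftrightarrow>
     (\<forall>d l l' cs. node_at T d (Node l cs) \<and> l' \<noteq> l \<longrightarrow>
        (\<forall>x \<in># cs. \<forall>y \<in># cs. label_value l' x = label_value l' y))"

lemma label_uniform_Leaf [simp]: "label_uniform (Leaf v)"
  by (simp add: label_uniform_def node_at_Leaf)

lemma label_uniform_Node:
  "label_uniform (Node l cs) \<longleftrightarrow>
     (\<forall>l'. l' \<noteq> l \<longrightarrow> (\<forall>x \<in># cs. \<forall>y \<in># cs. label_value l' x = label_value l' y)) \<and>
     (\<forall>c \<in># cs. label_uniform c)"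
proof
  assume L: "label_uniform (Node l cs)"
  have "label_uniform c" if "c \<in># cs" for c
    using L that unfolding label_uniform_def node_at_Node[of l cs] by blast
  moreover have "label_value l' x = label_value l' y"
    if "l' \<noteq> l" "x \<in># cs" "y \<in># cs" for l' x y
    using L that node_at.root[of "Node l cs"] unfolding label_uniform_def by blast
  ultimately show "(\<forall>l'. l' \<noteq> l \<longrightarrow> (\<forall>x \<in># cs. \<forall>y \<in># cs. label_value l' x = label_value l' y)) \<and>
     (\<forall>c \<in># cs. label_uniform c)" by blast
next
  assume "(\<forall>l'. l' \<noteq> l \<longrightarrow> (\<forall>x \<in># cs. \<forall>y \<in># cs. label_value l' x = label_value l' y)) \<and>
     (\<forall>c \<in># cs. label_uniform c)"
  then show "label_uniform (Node l cs)"
    unfolding label_uniform_def node_at_Node[of l cs] by blast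
qed

lemma node_at_proper:
  assumes "node_at T d t" "proper_cotree T"
  shows "proper_cotree t"
  using assms
proof induction
  case (child d t c)
  then show ?case by (cases t) (auto simp: proper_cotree_Node)
qed simp

text \<open>Only an internal root ties \<open>P d\<close> to a label, as a leaf has value 1 in
  either case. In a proper cotree labels alternate just as \<open>P\<close> does with the distance,
  so the tie passes on to the children.\<close>

lemma node_value_eq_label_value:
  assumes "\<And>d. P (Suc d) \<longleftrightarrow> \<not> P d"
  shows "\<lbrakk>proper_cotree t; \<And>l' cs. t = Node l' cs \<Longrightarrow> P d \<longleftrightarrow> l' = l\<rbrakk> \<Longrightarrow>
    node_value P t d = label_value l t"
proof (induction t arbitrary: d)
  case (Node l' cs)
  have "node_value P c (Suc d) = label_value l c" if "c \<in># cs" for c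
  proof (rule Node.IH[OF that])
    show "proper_cotree c" using Node.prems(1) that by (simp add: proper_cotree_Node)
    fix l'' ds assume "c = Node l'' ds"
    then have "l'' \<noteq> l'" using Node.prems(1) that by (auto simp: proper_cotree_Node)
    then show "P (Suc d) \<longleftrightarrow> l'' = l"
      using assms[of d] Node.prems(2)[of l' cs] by (cases l; cases l'; cases l'') auto
  qed
  then have "image_mset (\<lambda>c. node_value P c (Suc d)) cs = image_mset (label_value l) cs"
    by (intro image_mset_cong) auto
  then show ?case using Node.prems(2)[of l' cs] by (auto simp flip: set_image_mset)
qed simp

text \<open>
  Labels and the parity of the distance alternate together, so the root label plays no role:
  taking the maximum at the parent means taking sums at the children, which all have label \<open>l'\<close>
  unless they are leaves.
\<close>

lemma node_value_child:
  assumes "\<And>d. P (Suc d) \<longleftrightarrow> \<not> P d" "proper_cotree (Node l cs)" "x \<in># cs" "l' \<noteq> l" "\<not> P d"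
  shows "node_value P x (Suc d) = label_value l' x"
proof (rule node_value_eq_label_value[of P])
  show "P (Suc d) \<longleftrightarrow> \<not> P d" for d by (rule assms(1))
  show "proper_cotree x" using assms(2,3) by (simp add: proper_cotree_Node)
  fix l'' ds assume "x = Node l'' ds"
  then have "l'' \<noteq> l" using assms(2,3) by (auto simp: proper_cotree_Node)
  then show "P (Suc d) \<longleftrightarrow> l'' = l'"
    using assms(1,4,5) by (cases l; cases l'; cases l'') auto
qed

text \<open>The parity of its distance tells which procedure takes the maximum at a node. In that
  procedure its children carry the \<open>label_value\<close> for the label that the node does not
  have.\<close>

lemma uniform_assignment_iff:
  assumes "proper_cotree T"
  shows "uniform_assignment_property T \<longleftrightarrow> label_uniform T"
proof -
  let ?eq = "\<lambda>f t. \<forall>x \<in># children t. \<forall>y \<in># children t. f x = f y"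
  have node: "(odd d \<longrightarrow> ?eq (\<lambda>x. node_value even x (Suc d)) t) \<and>
      (even d \<longrightarrow> ?eq (\<lambda>x. node_value odd x (Suc d)) t) \<longleftrightarrow>
      (\<forall>l l' cs. t = Node l cs \<and> l' \<noteq> l \<longrightarrow>
        (\<forall>x \<in># cs. \<forall>y \<in># cs. label_value l' x = label_value l' y))" if at: "node_at T d t" for d t
  proof (cases t)
    case (Node l cs)
    have proper: "proper_cotree (Node l cs)" using node_at_proper[OF at assms] Node by simp
    \<comment> \<open>With two labels, a quantifier over the labels other than \<open>l\<close>
      concerns just one of them.\<close>
    obtain l' where l': "l' \<noteq> l" by (cases l) auto
    then have all: "(\<forall>k. k \<noteq> l \<longrightarrow> Q k) \<longleftrightarrow> Q l'" for Q
      by (metis node_label.exhaust)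
    have "?eq (\<lambda>x. node_value even x (Suc d)) t \<longleftrightarrow> ?eq (label_value l') t" if "odd d"
      using node_value_child[of even l cs _ l' d, OF _ proper _ l'] that Node by simp
    moreover have "?eq (\<lambda>x. node_value odd x (Suc d)) t \<longleftrightarrow> ?eq (label_value l') t" if "even d"
      using node_value_child[of odd l cs _ l' d, OF _ proper _ l'] that Node by simp
    ultimately have "(odd d \<longrightarrow> ?eq (\<lambda>x. node_value even x (Suc d)) t) \<and>
      (even d \<longrightarrow> ?eq (\<lambda>x. node_value odd x (Suc d)) t) \<longleftrightarrow> ?eq (label_value l') t" by blast
    then show ?thesis using all[of "\<lambda>k. ?eq (label_value k) t"] Node by simp
  qed simp
  have "uniform_assignment_property T \<longleftrightarrow>
      (\<forall>d t. node_at T d t \<longrightarrow> (odd d \<longrightarrow> ?eq (\<lambda>x. node_value even x (Suc d)) t) \<and>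
        (even d \<longrightarrow> ?eq (\<lambda>x. node_value odd x (Suc d)) t))"
    unfolding uniform_assignment_property_def by blast
  also have "\<dots> \<longleftrightarrow> (\<forall>d t. node_at T d t \<longrightarrow>
      (\<forall>l l' cs. t = Node l cs \<and> l' \<noteq> l \<longrightarrow>
        (\<forall>x \<in># cs. \<forall>y \<in># cs. label_value l' x = label_value l' y)))"
    by (intro all_cong1 imp_cong refl node)
  also have "\<dots> \<longleftrightarrow> label_uniform T"
    unfolding label_uniform_def by blast
  finally show ?thesis .
qed

section \<open>Induction along the cotree\<close>

text \<open>The claims go together because the criterion for \<open>equi_hued\<close> compares
  \<open>chi\<close> of the children at a union and \<open>alpha\<close> at a join. Only the arcs
  between leaves of \<open>T\<close> are prescribed, so the same \<open>E\<close> serves for all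
  subtrees.\<close>

lemma (in loopfree) cotree_equi_hued:
  assumes "distinct_leaves T" "proper_cotree T"
    "E \<inter> set_mset (leaves T) \<times> set_mset (leaves T) = parcs (cotree_graph T)"
  shows "chi E (set_mset (leaves T)) = label_value L1 T \<and>
    alpha E (set_mset (leaves T)) = label_value L0 T \<and>
    (equi_hued E (set_mset (leaves T)) \<longleftrightarrow> label_uniform T)"
  using assms
proof (induction T)
  case (Leaf v)
  then show ?case using equi_hued_singleton by simp
next
  case (Node l cs)
  note T = Node.prems(1,2)
  let ?P = "\<lambda>c. set_mset (leaves c)"
  have "cs \<noteq> {#}" and proper: "\<And>c. c \<in># cs \<Longrightarrow> proper_cotree c"
    using T(2) by (auto simp: proper_cotree_Node)
  then interpret vertex_partition E "set_mset cs" ?P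
    using distinct_leaves_Node(2)[OF T] leaves_nonempty[OF proper]
    by unfold_locales auto
  have V: "set_mset (leaves (Node l cs)) = V" by (simp add: V_def)
  have IH: "chi E (?P c) = label_value L1 c \<and> alpha E (?P c) = label_value L0 c \<and>
      (equi_hued E (?P c) \<longleftrightarrow> label_uniform c)" if c: "c \<in># cs" for c
  proof (rule Node.IH[OF c])
    have "?P c \<subseteq> ?P (Node l cs)" using c by auto
    then show "E \<inter> ?P c \<times> ?P c = parcs (cotree_graph c)"
      unfolding parcs_child_eq[OF T c] Node.prems(3)[symmetric] by blast
  qed (use c T distinct_leaves_Node(1) in \<open>auto simp: proper_cotree_Node\<close>)
  have arcs: "(u, v) \<in> E \<longleftrightarrow> l = L1"
    if "c \<in># cs" "c' \<in># cs" "c \<noteq> c'" "u \<in># leaves c" "v \<in># leaves c'" for c c' u v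
  proof -
    have "u \<in># leaves (Node l cs)" "v \<in># leaves (Node l cs)" using that by auto
    then have "(u, v) \<in> E \<longleftrightarrow> (u, v) \<in> parcs (cotree_graph (Node l cs))"
      unfolding Node.prems(3)[symmetric] by blast
    then show ?thesis using parcs_across[OF T that] by blast
  qed
  \<comment> \<open>No child occurs twice, so sums over the multiset of children are sums over the
    index set.\<close>
  have "mset_set (set_mset cs) = cs"
  proof (rule multiset_eqI)
    show "count (mset_set (set_mset cs)) c = count cs c" for c
      using distinct_leaves_Node(3)[OF T, of c]
      by (cases "c \<in># cs") (auto simp: count_mset_set' le_Suc_eq count_eq_zero_iff)
  qed
  then have sum: "\<Sum>\<^sub># (image_mset f cs) = sum f (set_mset cs)" for f :: "_ \<Rightarrow> nat"
    by (simp add: sum_unfold_sum_mset)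
  have vals: "(\<lambda>c. chi E (?P c)) ` set_mset cs = label_value L1 ` set_mset cs"
    "(\<lambda>c. alpha E (?P c)) ` set_mset cs = label_value L0 ` set_mset cs"
    "(\<Sum>c \<in># cs. chi E (?P c)) = (\<Sum>c \<in># cs. label_value L1 c)"
    "(\<Sum>c \<in># cs. alpha E (?P c)) = (\<Sum>c \<in># cs. label_value L0 c)"
    using IH by (auto intro!: image_cong arg_cong[where f = sum_mset] image_mset_cong)
  have other: "(\<forall>l'. l' \<noteq> L0 \<longrightarrow> Q l') \<longleftrightarrow> Q L1" "(\<forall>l'. l' \<noteq> L1 \<longrightarrow> Q l') \<longleftrightarrow> Q L0" for Q
    by (metis node_label.distinct(1) node_label.exhaust)+
  show ?case
  proof (cases l)
    case L0
    interpret vertex_union E "set_mset cs" ?P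
      by unfold_locales (metis arcs L0 node_label.distinct(1))
    have "equi_hued E V \<longleftrightarrow> label_uniform (Node l cs)"
      by (simp add: equi_hued_union label_uniform_Node other L0 IH conj_commute cong: ball_cong)
    moreover have "chi E V = label_value L1 (Node l cs)"
      by (simp add: chi_union vals L0)
    moreover have "alpha E V = label_value L0 (Node l cs)"
      using vals by (simp add: alpha_union L0 sum)
    ultimately show ?thesis unfolding V by blast
  next
    case L1
    interpret vertex_join E "set_mset cs" ?P
      by unfold_locales (metis arcs L1)
    have "equi_hued E V \<longleftrightarrow> label_uniform (Node l cs)"
      by (simp add: equi_hued_join label_uniform_Node other L1 IH conj_commute cong: ball_cong)
    moreover have "alpha E V = label_value L0 (Node l cs)"
      by (simp add: alpha_join vals L1)
    moreover have "V \<inter> ?P c = ?P c" if "c \<in># cs" for c using part_subset[OF that] by blast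
    then have "chi E V = label_value L1 (Node l cs)"
      using vals chi_join[of V] by (simp add: L1 sum)
    ultimately show ?thesis unfolding V by blast
  qed
qed

section \<open>Back to the definitions for graphs\<close>

lemma (in loopfree) colorable_induced_iff:
  assumes "E = parcs G" "finite S"
  shows "colorable (with_proj G \<restriction> S) k \<longleftrightarrow> chi E S \<le> k"
proof -
  have "arcs_ends (with_proj G \<restriction> S) = {(u, v) \<in> E. u \<in> S \<and> v \<in> S}"
    by (auto simp: arcs_ends_conv assms(1))
  then show ?thesis
    unfolding chi_le_iff[OF assms(2)] colorable_def colorable_set_def proper_coloring_def
    by (simp add: image_subset_iff) blast
qed

text \<open>A maximum independent set is maximal for k = 1, so i = 1 gives \<open>alpha\<close> as
  the order divided by \<open>chi\<close>. Conversely k = \<open>chi\<close> gives the order as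
  \<open>chi\<close> times \<open>alpha\<close>.\<close>

lemma (in loopfree) well_equi_hued_iff:
  assumes E: "E = parcs G" "parcs G \<subseteq> pverts G \<times> pverts G"
    and fin: "finite (pverts G)" and ne: "pverts G \<noteq> {}"
  shows "well_equi_hued (with_proj G) \<longleftrightarrow> equi_hued E (pverts G)"
proof -
  let ?G = "with_proj G" and ?V = "pverts G"
  have max: "maximal_colorable ?G k S \<longleftrightarrow> max_colorable_set E ?V k S" for k S
  proof (cases "S \<subseteq> ?V")
    case True
    have "colorable (?G \<restriction> S') k \<longleftrightarrow> chi E S' \<le> k" if "S' \<subseteq> ?V" for S'
      using colorable_induced_iff[OF E(1)] finite_subset[OF that fin] .
    then show ?thesis
      using True unfolding maximal_colorable_def max_colorable_set_def by (simp add: not_le)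
  qed (simp add: maximal_colorable_def max_colorable_set_def)
  have "colorable ?G k \<longleftrightarrow> colorable_set E ?V k" for k
    using E unfolding colorable_def colorable_set_def proper_coloring_def
    by (simp add: image_subset_iff) blast
  then have chrom: "chromatic_number ?G = chi E ?V"
    unfolding chromatic_number_def chi_def by presburger
  let ?\<chi> = "chi E ?V" and ?n = "card ?V"
  have \<chi>: "?\<chi> > 0" using chi_pos[OF fin ne] .
  \<comment> \<open>All maximal sets for k have the same size, so the definite description picks the
    size of any one of them.\<close>
  have hue: "hue_number ?G k = card S"
    if "well_hued ?G" "k \<ge> 1" "max_colorable_set E ?V k S" for k S
    unfolding hue_number_def max using that unfolding well_hued_def max by (intro the_equality) blast+
  show ?thesis
  proof
    assume L: "well_equi_hued ?G"
    then have wh: "well_hued ?G"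
      and eq: "\<And>k. k \<in> {1..?\<chi>} \<Longrightarrow> real (hue_number ?G k) = real k / real ?\<chi> * real ?n"
      unfolding well_equi_hued_def chrom by auto
    obtain A where A: "max_colorable_set E ?V 1 A" "card A = alpha E ?V"
      using alpha_max_colorable_set[OF fin] .
    then have alpha: "real (alpha E ?V) = real ?n / real ?\<chi>"
      using hue[OF wh _ A(1)] eq[of 1] \<chi> by simp
    show "equi_hued E ?V"
      unfolding equi_hued_def
    proof (intro allI impI)
      fix k S assume k: "k \<le> ?\<chi>" "max_colorable_set E ?V k S"
      show "card S = k * alpha E ?V"
      proof (cases "k = 0")
        case True
        then show ?thesis using k(2) max_colorable_set_0[OF fin] by simp
      next
        case False
        then have "real (card S) = real k / real ?\<chi> * real ?n"
          using hue[OF wh _ k(2)] eq[of k] k(1) by simp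
        also have "\<dots> = real (k * alpha E ?V)" by (simp add: alpha)
        finally show ?thesis by linarith
      qed
    qed
  next
    assume R: "equi_hued E ?V"
    \<comment> \<open>\<open>well_hued\<close> also concerns k above \<open>chi\<close>, where only
      the whole vertex set is maximal; hence the minimum.\<close>
    have card: "card S = min k ?\<chi> * alpha E ?V" if "max_colorable_set E ?V k S" for k S
    proof (cases "k \<le> ?\<chi>")
      case True
      then show ?thesis using equi_huedD[OF R that] by simp
    next
      case False
      then have "max_colorable_set E ?V ?\<chi> S" using that max_colorable_set_full by simp
      then show ?thesis using equi_huedD[OF R] False by simp
    qed
    have wh: "well_hued ?G" unfolding well_hued_def max using card by metis
    have n: "?n = ?\<chi> * alpha E ?V"
      using card[of ?\<chi> ?V] max_colorable_set_full by simp
    have "real (hue_number ?G k) = real k / real ?\<chi> * real ?n" if k: "k \<in> {1..?\<chi>}" for k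
    proof -
      obtain S where S: "max_colorable_set E ?V k S" using ex_max_colorable_set[OF fin] ..
      then have "hue_number ?G k = k * alpha E ?V" using hue[OF wh _ S] card[OF S] k by simp
      then show ?thesis using \<chi> n by simp
    qed
    then show "well_equi_hued ?G" using wh unfolding well_equi_hued_def chrom by simp
  qed
qed

theorem theorem11:
  fixes G :: "'a pair_pre_digraph"
  assumes "cograph G"
  shows "well_equi_hued (with_proj G) \<longleftrightarrow> uniform_assignment_property (cotree_of G)"
proof -
  let ?T = "cotree_of G"
  have T: "distinct_leaves ?T" "proper_cotree ?T" "cotree_graph ?T = G"
    using is_cotree_cotree_of[OF assms] by (simp_all add: is_cotree_iff)
  have G: "finite (pverts G)" "parcs G \<subseteq> pverts G \<times> pverts G" "\<And>v. (v, v) \<notin> parcs G"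
    using cograph_pair_graph[OF assms] by (auto simp: pair_graph_iff)
  have V: "set_mset (leaves ?T) = pverts G" using pverts_cotree_graph[of ?T] T(3) by simp
  have "pverts G \<noteq> {}" using leaves_nonempty[OF T(2)] V by auto
  interpret loopfree "parcs G" by unfold_locales (rule G(3))
  have "well_equi_hued (with_proj G) \<longleftrightarrow> equi_hued (parcs G) (pverts G)"
    using well_equi_hued_iff G \<open>pverts G \<noteq> {}\<close> by blast
  also have "\<dots> \<longleftrightarrow> label_uniform ?T"
    using cotree_equi_hued[OF T(1,2)] T(3) V G(2) by (simp add: Int_absorb2)
  also have "\<dots> \<longleftrightarrow> uniform_assignment_property ?T"
    using uniform_assignment_iff[OF T(2)] by simp
  finally show ?thesis .
qed

end
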